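(* For every integer $n\ge 1$, $$\delta(n)=\min_{0\le v\le n}\{\delta_P(v)+\delta_C(n-v)\}=n+2+2\min_{0\le v\le n}\{C(v)-T(n-v)-v\}.$$
   Context: $\mathcal{T}_\infty$ is the infinite binary tree with all leaves at the same level: its vertices are the pairs $(i,j)$ of integers with $i\ge 1$, $j\ge 0$; the vertex $(i,j)$ has parent $(i+1,\lfloor j/2\rfloor)$, and the edges join each vertex to its parent. For a finite vertex set $S$, $\overline S$ is its complement and $(S,\overline S)$ is the set of edges with one end in $S$ and the other in $\overline S$. For $n\ge 1$: $\delta(n)$ is the minimum of $|(S,\overline S)|$ over all $S\subset V(\mathcal{T}_\infty)$ with $|S|=n$; $\delta_C(n)$ is the minimum over those $S$ with $|S|=n$ that induce a connected subgraph; $\delta_P(n)$ is the minimum over those $S$ with $|S|=n$ for which $\overline S$ induces a connected subgraph. By convention $\delta_P(0)=\delta_C(0)=0$. Tanny sequence: $T(0)=T(1)=T(2)=1$ and $T(n)=T(n-1-T(n-1))+T(n-2-T(n-2))$ for $n>2$. Conolly sequence: $C(0)=0$, $C(1)=1$, $C(2)=2$ and $C(n)=C(n-C(n-1))+C(n-1-C(n-2))$ for $n>2$. *)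

theory Defs
  imports "Graph_Theory.Digraph_Component"
begin

section \<open>The infinite binary tree\<close>

definition parent :: "nat \<times> nat \<Rightarrow> nat \<times> nat" where
  "parent v = (fst v + 1, snd v div 2)"

text \<open>
  The undirected tree is given by its orientation towards the parents, so that each edge is
  represented by exactly one arc. The library predicate \<^const>\<open>connected\<close> looks at the symmetric
  closure, i.e. it is connectedness of the underlying undirected graph. It is false for the graph
  without vertices.
\<close>

definition T_inf :: "(nat \<times> nat, (nat \<times> nat) \<times> (nat \<times> nat)) pre_digraph" where
  "T_inf = \<lparr> verts = {(i, j). i \<ge> 1}, arcs = {(v, parent v) | v. fst v \<ge> 1}, tail = fst, head = snd \<rparr>"

definition edge_boundary :: "(nat \<times> nat) set \<Rightarrow> ((nat \<times> nat) \<times> (nat \<times> nat)) set" where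
  "edge_boundary S =
     {e \<in> arcs T_inf. tail T_inf e \<in> S \<and> head T_inf e \<in> verts T_inf - S
                    \<or> tail T_inf e \<in> verts T_inf - S \<and> head T_inf e \<in> S}"

lemma wf_digraph_T_inf: "wf_digraph T_inf"
  by unfold_locales (auto simp: T_inf_def parent_def)

lemma finite_edge_boundary:
  assumes "finite S"
  shows "finite (edge_boundary S)"
proof -
  have "edge_boundary S \<subseteq>
      (\<lambda>v. (v, parent v)) ` (S \<union> (\<lambda>(u, b). (fst u - 1, 2 * snd u + b)) ` (S \<times> {0, 1}))"
  proof
    fix e assume "e \<in> edge_boundary S"
    then obtain v where e: "e = (v, parent v)" and "v \<in> S \<or> parent v \<in> S"
      by (auto simp: edge_boundary_def T_inf_def)
    moreover have "v = (\<lambda>(u, b). (fst u - 1, 2 * snd u + b)) (parent v, snd v mod 2)"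
      by (simp add: parent_def prod_eq_iff)
    moreover have "snd v mod 2 \<in> {0, 1}"
      by auto
    ultimately show "e \<in> (\<lambda>v. (v, parent v)) ` (S \<union> (\<lambda>(u, b). (fst u - 1, 2 * snd u + b)) ` (S \<times> {0, 1}))"
      by (metis (no_types, lifting) SigmaI UnCI imageI)
  qed
  then show ?thesis
    by (rule finite_subset) (use assms in auto)
qed


section \<open>The isoperimetric functions\<close>

text \<open>
  Each \<^const>\<open>Inf\<close> below is an infimum over a nonempty set of natural numbers, hence a minimum:
  there are connected sets of every size \<open>n \<ge> 1\<close>, and removing leaves of the tree leaves a
  connected graph.
\<close>

definition delta :: "nat \<Rightarrow> nat" where
  "delta n = Inf {card (edge_boundary S) | S. S \<subseteq> verts T_inf \<and> finite S \<and> card S = n}"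

definition delta_C :: "nat \<Rightarrow> nat" where
  "delta_C n = (if n = 0 then 0 else
     Inf {card (edge_boundary S) | S. S \<subseteq> verts T_inf \<and> finite S \<and> card S = n
            \<and> connected (T_inf \<restriction> S)})"

definition delta_P :: "nat \<Rightarrow> nat" where
  "delta_P n = (if n = 0 then 0 else
     Inf {card (edge_boundary S) | S. S \<subseteq> verts T_inf \<and> finite S \<and> card S = n
            \<and> connected (T_inf \<restriction> (verts T_inf - S))})"


section \<open>The Tanny and Conolly sequences\<close>

text \<open>
  Subtraction on \<^typ>\<open>nat\<close> is truncated; the bounds \<open>tanny_bounds\<close> and \<open>conolly_bounds\<close> below
  imply that none of the subtractions in the recursive calls truncates. For \<open>conolly\<close> these
  bounds are also what makes the recursion terminate.
\<close>

function tanny :: "nat \<Rightarrow> nat" where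
  "tanny n = (if n \<le> 2 then 1
              else tanny (n - 1 - tanny (n - 1)) + tanny (n - 2 - tanny (n - 2)))"
  by auto
termination
  by (relation "measure id") auto

declare tanny.simps [simp del]

function (domintros) conolly :: "nat \<Rightarrow> nat" where
  "conolly n = (if n \<le> 2 then n
                else conolly (n - conolly (n - 1)) + conolly (n - 1 - conolly (n - 2)))"
  by auto

text \<open>Both sequences grow by at most one in each step, by the following common argument.\<close>

lemma slow_growth_step:
  fixes f :: "nat \<Rightarrow> nat"
  assumes "\<And>m. m \<in> {s, p, q} \<Longrightarrow> f m \<le> f (Suc m) \<and> f (Suc m) \<le> Suc (f m)"
    and "p = s \<or> p = Suc s" "q = p \<or> q = Suc p" "r = q \<or> r = Suc q"
    and "r = Suc q \<Longrightarrow> f q + f p = f p + f s"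
  shows "f q + f p \<le> f r + f q \<and> f r + f q \<le> Suc (f q + f p)"
  using assms(1)[of s] assms(1)[of p] assms(1)[of q] assms(2-5) by auto

lemma tanny_small: "n \<le> 2 \<Longrightarrow> tanny n = 1"
  by (simp add: tanny.simps)

lemma tanny_rec:
  "n > 2 \<Longrightarrow> tanny n = tanny (n - 1 - tanny (n - 1)) + tanny (n - 2 - tanny (n - 2))"
  by (subst tanny.simps) simp

lemma tanny_3: "tanny 3 = 2" and tanny_4: "tanny 4 = 2"
proof -
  show 3: "tanny 3 = 2"
    by (simp add: tanny_rec[of 3] tanny_small)
  show "tanny 4 = 2"
    by (simp add: tanny_rec[of 4] tanny_small 3)
qed

lemma tanny_step: "tanny n \<le> tanny (Suc n) \<and> tanny (Suc n) \<le> Suc (tanny n)"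
proof (induction n rule: less_induct)
  case (less n)
  show ?case
  proof (cases "n \<le> 3")
    case True
    then consider "n \<le> 1" | "n = 2" | "n = 3" by linarith
    then show ?thesis
      by cases (auto simp: tanny_small tanny_3 tanny_4)
  next
    case False
    then obtain k where n: "n = k + 4"
      by (metis add.commute le_add_diff_inverse not_less_eq_eq numeral_3_eq_3 numeral_eq_Suc
          pred_numeral_simps(2) semiring_norm(26,27))
    have bd: "1 \<le> tanny m \<and> (1 \<le> m \<longrightarrow> tanny m \<le> m)" if "m \<le> n" for m
      using that
    proof (induction m)
      case (Suc m)
      then show ?case
        using less.IH[of m] by (cases "m = 0") (auto simp: tanny_small)
    qed (simp add: tanny_small)
    define p where "p = k + 2 - tanny (k + 2)"
    define q where "q = k + 3 - tanny (k + 3)"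
    define r where "r = k + 4 - tanny (k + 4)"
    define s where "s = k + 1 - tanny (k + 1)"
    have ix: "k + 5 - 1 = k + 4" "k + 5 - 2 = k + 3" "k + 4 - 1 = k + 3" "k + 4 - 2 = k + 2"
      "k + 3 - 1 = k + 2" "k + 3 - 2 = k + 1"
      by simp_all
    have T5: "tanny (k + 5) = tanny r + tanny q"
      using tanny_rec[of "k + 5"] unfolding ix p_def q_def r_def s_def by simp
    have T4: "tanny (k + 4) = tanny q + tanny p"
      using tanny_rec[of "k + 4"] unfolding ix p_def q_def r_def s_def by simp
    have T3: "tanny (k + 3) = tanny p + tanny s"
      using tanny_rec[of "k + 3"] unfolding ix p_def q_def r_def s_def by simp
    note T = T5 T4 T3
    have st: "tanny (k + 3) \<le> tanny (k + 4)" "tanny (k + 4) \<le> Suc (tanny (k + 3))"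
      "tanny (k + 2) \<le> tanny (k + 3)" "tanny (k + 3) \<le> Suc (tanny (k + 2))"
      "tanny (k + 1) \<le> tanny (k + 2)" "tanny (k + 2) \<le> Suc (tanny (k + 1))"
      using less.IH[of "k + 3"] less.IH[of "k + 2"] less.IH[of "k + 1"]
      by (simp_all add: n eval_nat_numeral)
    note b = bd[of "k + 4"] bd[of "k + 3"] bd[of "k + 2"] bd[of "k + 1"]
    have "tanny q + tanny p \<le> tanny r + tanny q \<and> tanny r + tanny q \<le> Suc (tanny q + tanny p)"
    proof (rule slow_growth_step[where f = tanny and s = s])
      show "tanny m \<le> tanny (Suc m) \<and> tanny (Suc m) \<le> Suc (tanny m)" if "m \<in> {s, p, q}" for m
        using that n b by (intro less.IH) (auto simp: p_def q_def s_def)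
      show "p = s \<or> p = Suc s" "q = p \<or> q = Suc p" "r = q \<or> r = Suc q"
        using st b n unfolding p_def q_def r_def s_def by auto
      assume "r = Suc q"
      then have "tanny (k + 4) = tanny (k + 3)"
        using st b n unfolding q_def r_def by auto
      then show "tanny q + tanny p = tanny p + tanny s"
        by (simp add: T)
    qed
    then show ?thesis
      using T by (simp add: n eval_nat_numeral)
  qed
qed

lemma tanny_bounds: "1 \<le> tanny n" "1 \<le> n \<Longrightarrow> tanny n \<le> n"
proof -
  have "1 \<le> tanny n \<and> (1 \<le> n \<longrightarrow> tanny n \<le> n)"
  proof (induction n)
    case (Suc n)
    then show ?case
      using tanny_step[of n] by (cases "n = 0") (auto simp: tanny_small)
  qed (simp add: tanny_small)
  then show "1 \<le> tanny n" "1 \<le> n \<Longrightarrow> tanny n \<le> n"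
    by auto
qed

lemma conolly_dom_small: "n \<le> 2 \<Longrightarrow> conolly_dom n"
  by (rule conolly.domintros) auto

lemma conolly_psmall: "n \<le> 2 \<Longrightarrow> conolly n = n"
  by (subst conolly.psimps) (auto intro: conolly_dom_small)

lemma conolly_prec:
  assumes "n > 2" "conolly_dom (n - 1)" "conolly_dom (n - 2)"
    "conolly_dom (n - conolly (n - 1))" "conolly_dom (n - 1 - conolly (n - 2))"
  shows "conolly_dom n"
    "conolly n = conolly (n - conolly (n - 1)) + conolly (n - 1 - conolly (n - 2))"
proof -
  show "conolly_dom n"
    by (rule conolly.domintros) (use assms in auto)
  then show "conolly n = conolly (n - conolly (n - 1)) + conolly (n - 1 - conolly (n - 2))"
    by (subst conolly.psimps) (use assms in auto)
qed

lemma conolly_3: "conolly_dom 3" "conolly 3 = 2"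
  using conolly_prec[of 3] by (simp_all add: conolly_dom_small conolly_psmall)

lemma conolly_4: "conolly_dom 4" "conolly 4 = 3"
  using conolly_prec[of 4] by (simp_all add: conolly_dom_small conolly_psmall conolly_3)

lemma conolly_dom_step:
  "conolly_dom n \<and> (1 \<le> n \<longrightarrow> 1 \<le> conolly n \<and> conolly n \<le> n \<and>
     conolly (n - 1) \<le> conolly n \<and> conolly n \<le> Suc (conolly (n - 1)))"
proof (induction n rule: less_induct)
  case (less n)
  show ?case
  proof (cases "n \<le> 4")
    case True
    then consider "n \<le> 2" | "n = 3" | "n = 4" by linarith
    then show ?thesis
      by cases (auto simp: conolly_dom_small conolly_psmall conolly_3 conolly_4)
  next
    case False
    define k where "k = n - 5"
    have n: "n = k + 5"
      using False by (simp add: k_def)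
    have dom: "conolly_dom m" if "m < n" for m
      using less.IH that by blast
    have bd: "1 \<le> conolly m \<and> conolly m \<le> m" if "1 \<le> m" "m < n" for m
      using less.IH that by blast
    note b = bd[of "k + 4"] bd[of "k + 3"] bd[of "k + 2"] bd[of "k + 1"]
    have step: "conolly m \<le> conolly (Suc m) \<and> conolly (Suc m) \<le> Suc (conolly m)" if "Suc m < n" for m
      using less.IH[of "Suc m"] that by simp
    define p where "p = k + 3 - conolly (k + 2)"
    define q where "q = k + 4 - conolly (k + 3)"
    define r where "r = k + 5 - conolly (k + 4)"
    define s where "s = k + 2 - conolly (k + 1)"
    have lt: "p < n" "q < n" "r < n" "s < n"
      using b n unfolding p_def q_def r_def s_def by auto
    have ix: "k + 5 - 1 = k + 4" "k + 5 - 2 = k + 3" "k + 4 - 1 = k + 3" "k + 4 - 2 = k + 2"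
      "k + 3 - 1 = k + 2" "k + 3 - 2 = k + 1"
      by simp_all
    have dom5: "conolly_dom (k + 5)" and C5: "conolly (k + 5) = conolly r + conolly q"
      using conolly_prec[of "k + 5", unfolded ix] dom[of "k + 4"] dom[of "k + 3"]
        dom[OF lt(3)] dom[OF lt(2)] n
      unfolding q_def r_def by auto
    have C4: "conolly (k + 4) = conolly q + conolly p"
      using conolly_prec(2)[of "k + 4", unfolded ix] dom[of "k + 3"] dom[of "k + 2"] dom[OF lt(2)] dom[OF lt(1)] n
      unfolding p_def q_def by auto
    have C3: "conolly (k + 3) = conolly p + conolly s"
      using conolly_prec(2)[of "k + 3", unfolded ix] dom[of "k + 2"] dom[of "k + 1"] dom[OF lt(1)] dom[OF lt(4)] n
      unfolding p_def s_def by auto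
    note C = dom5 C5 C4 C3
    have st: "conolly (k + 3) \<le> conolly (k + 4)" "conolly (k + 4) \<le> Suc (conolly (k + 3))"
      "conolly (k + 2) \<le> conolly (k + 3)" "conolly (k + 3) \<le> Suc (conolly (k + 2))"
      "conolly (k + 1) \<le> conolly (k + 2)" "conolly (k + 2) \<le> Suc (conolly (k + 1))"
      using step[of "k + 3"] step[of "k + 2"] step[of "k + 1"] by (simp_all add: n eval_nat_numeral)
    have "conolly q + conolly p \<le> conolly r + conolly q \<and>
          conolly r + conolly q \<le> Suc (conolly q + conolly p)"
    proof (rule slow_growth_step[where f = conolly and s = s])
      show "conolly m \<le> conolly (Suc m) \<and> conolly (Suc m) \<le> Suc (conolly m)"
        if "m \<in> {s, p, q}" for m
        using that n b by (intro step) (auto simp: p_def q_def s_def)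
      show "p = s \<or> p = Suc s" "q = p \<or> q = Suc p" "r = q \<or> r = Suc q"
        using st b n unfolding p_def q_def r_def s_def by auto
      assume "r = Suc q"
      then have "conolly (k + 4) = conolly (k + 3)"
        using st b n unfolding q_def r_def by auto
      then show "conolly q + conolly p = conolly p + conolly s"
        by (simp add: C)
    qed
    then show ?thesis
      using C(1) b unfolding n ix C(2,3) by auto
  qed
qed

termination conolly
  using conolly_dom_step by blast

declare conolly.simps [simp del]

lemma conolly_bounds: "1 \<le> n \<Longrightarrow> 1 \<le> conolly n" "conolly n \<le> n"
  using conolly_dom_step[of n] conolly_psmall[of 0] by (cases "n = 0"; simp)+

end

theory Submission
  imports Defs
begin

text \<open>
  A set with \<open>n\<close> vertices, \<open>L\<close> of them leaves of the tree, and with \<open>c\<close> components has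
  \<open>n + 2 c - 2 L\<close> boundary edges. Halving level sizes shows that a connected set with \<open>m\<close> leaves needs
  \<open>m + \<lceil>m/2\<rceil> + \<lceil>m/4\<rceil> + \<dots>\<close> vertices (up to the first term \<open>1\<close>), and that a set with connected
  complement and \<open>q\<close> leaves has at most \<open>q + \<lfloor>q/2\<rfloor> + \<lfloor>q/4\<rfloor> + \<dots>\<close> vertices; the Tanny and Conolly
  sequences are the inverses of these two functions. Two connected sets can be replaced, without
  enlarging the boundary, by one full subtree and one connected set. Repeating this leaves a
  union of full subtrees together with one connected set.
\<close>


section \<open>Closed descriptions of the two sequences\<close>

text \<open>For fixed size, a small boundary means a large value of leaves minus components. A
  connected set of size \<open>a\<close> scores at most \<open>tanny a - 1\<close>, a set of size
  \<open>w\<close> with connected complement at most \<open>w - conolly w\<close>. The exchange is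
  an inequality between these scores; no vertices are moved. It works because a full tree with
  \<open>2 ^ h\<close> leaves has \<open>2 ^ Suc h - 1\<close> vertices, the value of both halving
  sums at \<open>2 ^ h\<close>, and so is optimal in both roles.

  The full subtrees split off along the way collapse into one number \<open>v\<close> because
  \<open>conolly\<close> is subadditive. Extremal sets are built only for the final pair
  \<open>v\<close>, \<open>n - v\<close>, over disjoint ranges of leaves.

  The two roundings come from adjacent rows: \<open>s\<close> vertices in a row have at least
  \<open>s / 2\<close> parents, rounded up, and contain both children of at most
  \<open>s / 2\<close> vertices, rounded down.\<close>

fun ceil_halves :: "nat \<Rightarrow> nat" where
  "ceil_halves m = (if m \<le> 1 then m else m + ceil_halves ((m + 1) div 2))"

text \<open>By Legendre's formula this is the exponent of 2 in the factorial of
  \<open>2 * m\<close>.\<close>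

fun floor_halves :: "nat \<Rightarrow> nat" where
  "floor_halves m = (if m = 0 then 0 else m + floor_halves (m div 2))"

declare ceil_halves.simps [simp del] floor_halves.simps [simp del]

lemma ceil_halves_small [simp]:
  "ceil_halves 0 = 0" "ceil_halves (Suc 0) = Suc 0" "ceil_halves 2 = 3" "ceil_halves 3 = 6"
  by (simp_all add: ceil_halves.simps)

lemma ceil_halves_rec: "2 \<le> m \<Longrightarrow> ceil_halves m = m + ceil_halves ((m + 1) div 2)"
  by (subst ceil_halves.simps) simp

lemma ceil_halves_le_rec: "ceil_halves m \<le> m + ceil_halves ((m + 1) div 2)"
  by (subst ceil_halves.simps) simp

lemma floor_halves_0 [simp]: "floor_halves 0 = 0"
  by (simp add: floor_halves.simps)

lemma floor_halves_rec: "floor_halves m = m + floor_halves (m div 2)"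
  by (cases "m = 0") (simp, subst floor_halves.simps, simp)

lemma ceil_halves_less_Suc: "ceil_halves m < ceil_halves (Suc m)"
proof (induction m rule: less_induct)
  case (less m)
  show ?case
  proof (cases "m \<le> 1")
    case True
    then have "m = 0 \<or> m = 1" by auto
    then show ?thesis by (auto simp flip: numeral_2_eq_2)
  next
    case False
    then have eq: "ceil_halves m = m + ceil_halves ((m + 1) div 2)"
      "ceil_halves (Suc m) = Suc m + ceil_halves ((Suc m + 1) div 2)"
      using ceil_halves_rec[of m] ceil_halves_rec[of "Suc m"] by auto
    have "(Suc m + 1) div 2 = (m + 1) div 2 \<or> (Suc m + 1) div 2 = Suc ((m + 1) div 2)"
      by presburger
    then show ?thesis
      using less.IH[of "(m + 1) div 2"] False eq by fastforce
  qed
qed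

lemma strict_mono_ceil_halves: "strict_mono ceil_halves"
  by (simp add: ceil_halves_less_Suc strict_mono_Suc_iff)

lemma floor_halves_less_Suc: "floor_halves m < floor_halves (Suc m)"
proof (induction m rule: less_induct)
  case (less m)
  have eq: "floor_halves m = m + floor_halves (m div 2)"
    "floor_halves (Suc m) = Suc m + floor_halves (Suc m div 2)"
    by (rule floor_halves_rec)+
  have "Suc m div 2 = m div 2 \<or> (Suc m div 2 = Suc (m div 2) \<and> m div 2 < m)"
    by presburger
  then show ?case
    using less.IH[of "m div 2"] eq by auto
qed

lemma strict_mono_floor_halves: "strict_mono floor_halves"
  by (simp add: floor_halves_less_Suc strict_mono_Suc_iff)

lemma ceil_halves_mono: "m \<le> k \<Longrightarrow> ceil_halves m \<le> ceil_halves k"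
  by (simp add: strict_mono_ceil_halves strict_mono_less_eq)

lemma floor_halves_mono: "m \<le> k \<Longrightarrow> floor_halves m \<le> floor_halves k"
  by (simp add: strict_mono_floor_halves strict_mono_less_eq)

lemma ceil_halves_unique:
  assumes "ceil_halves x \<le> n" "n < ceil_halves (Suc x)" "ceil_halves y \<le> n" "n < ceil_halves (Suc y)"
  shows "x = y"
proof -
  have "ceil_halves x < ceil_halves (Suc y)" "ceil_halves y < ceil_halves (Suc x)"
    using assms by linarith+
  then show ?thesis
    by (simp add: strict_mono_less[OF strict_mono_ceil_halves])
qed

lemma floor_halves_unique:
  assumes "floor_halves x < n" "n \<le> floor_halves (Suc x)" "floor_halves y < n" "n \<le> floor_halves (Suc y)"
  shows "x = y"
proof -
  have "floor_halves x < floor_halves (Suc y)" "floor_halves y < floor_halves (Suc x)"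
    using assms by linarith+
  then show ?thesis
    by (simp add: strict_mono_less[OF strict_mono_floor_halves])
qed

text \<open>Rounding down is superadditive in each term of the sum.\<close>

lemma floor_halves_superadd: "floor_halves x + floor_halves y \<le> floor_halves (x + y)"
proof (induction x arbitrary: y rule: less_induct)
  case (less x)
  show ?case
  proof (cases "x = 0")
    case False
    then have "floor_halves (x div 2) + floor_halves (y div 2) \<le> floor_halves (x div 2 + y div 2)"
      by (intro less.IH) auto
    also have "\<dots> \<le> floor_halves ((x + y) div 2)"
      by (intro floor_halves_mono) presburger
    finally show ?thesis
      by (simp add: floor_halves_rec[of x] floor_halves_rec[of y] floor_halves_rec[of "x + y"])
  qed simp
qed

lemma floor_halves_power: "floor_halves (2 ^ h) = 2 ^ Suc h - 1"
proof (induction h)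
  case 0
  show ?case by (simp add: floor_halves.simps)
next
  case (Suc h)
  have "floor_halves (2 ^ Suc h) = 2 ^ Suc h + (2 ^ Suc h - 1)"
    using floor_halves_rec[of "2 ^ Suc h"] Suc by simp
  also have "\<dots> = 2 ^ Suc (Suc h) - 1"
    using one_le_power[of "2::nat" "Suc h"] by (simp add: mult_2)
  finally show ?case .
qed

lemma ceil_halves_power: "ceil_halves (2 ^ h) = 2 ^ Suc h - 1"
proof (induction h)
  case 0
  show ?case by simp
next
  case (Suc h)
  have "(2 ^ Suc h + 1) div 2 = (2::nat) ^ h" by simp
  moreover have "(2::nat) \<le> 2 ^ Suc h"
    using power_increasing[of 1 "Suc h" "2::nat"] by simp
  ultimately have "ceil_halves (2 ^ Suc h) = 2 ^ Suc h + (2 ^ Suc h - 1)"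
    using ceil_halves_rec[of "2 ^ Suc h"] Suc by simp
  also have "\<dots> = 2 ^ Suc (Suc h) - 1"
    using one_le_power[of "2::nat" "Suc h"] by (simp add: mult_2)
  finally show ?case .
qed

section \<open>Gaps of the halving sums and the Tanny recurrence\<close>

lemma ceil_halves_odd_gap:
  assumes "odd m" "3 \<le> m"
  shows "ceil_halves (Suc m) = Suc (ceil_halves m)"
proof -
  have "(Suc m + 1) div 2 = (m + 1) div 2"
    using assms by presburger
  then show ?thesis
    using assms ceil_halves_rec[of m] ceil_halves_rec[of "Suc m"] by simp
qed

lemma floor_halves_even_gap:
  assumes "even m"
  shows "floor_halves (Suc m) = Suc (floor_halves m)"
proof -
  have "Suc m div 2 = m div 2"
    using assms by presburger
  then show ?thesis
    using floor_halves_rec[of m] floor_halves_rec[of "Suc m"] by simp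
qed

text \<open>The indices \<open>k\<close> with
  \<open>ceil_halves t \<le> k < ceil_halves (Suc t)\<close> form the block where
  \<open>tanny\<close> will have the value \<open>t\<close>. Shifting by \<open>t\<close> removes
  the leading term of the sum, so the block lands in that of \<open>(t + 1) div 2\<close>, while its
  last index becomes the first index of the block of \<open>(t + 2) div 2\<close>.\<close>

lemma ceil_halves_half:
  assumes "2 \<le> t" "ceil_halves t \<le> k" "k < ceil_halves (Suc t)"
    and "ceil_halves x \<le> k - t" "k - t < ceil_halves (Suc x)"
  shows "k + 1 < ceil_halves (Suc t) \<Longrightarrow> x = (t + 1) div 2"
    and "k + 1 = ceil_halves (Suc t) \<Longrightarrow> x = (t + 2) div 2"
proof -
  have t: "ceil_halves t = t + ceil_halves ((t + 1) div 2)"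
    "ceil_halves (Suc t) = Suc t + ceil_halves ((t + 2) div 2)"
    using ceil_halves_rec[of t] ceil_halves_rec[of "Suc t"] assms(1) by simp_all
  have half: "(t + 2) div 2 \<le> Suc ((t + 1) div 2)"
    by presburger
  show "x = (t + 1) div 2" if "k + 1 < ceil_halves (Suc t)"
  proof (rule ceil_halves_unique[OF assms(4,5)])
    show "ceil_halves ((t + 1) div 2) \<le> k - t"
      using assms t by linarith
    have "k - t < ceil_halves ((t + 2) div 2)"
      using that t assms(2) by linarith
    also have "\<dots> \<le> ceil_halves (Suc ((t + 1) div 2))"
      by (rule ceil_halves_mono[OF half])
    finally show "k - t < ceil_halves (Suc ((t + 1) div 2))" .
  qed
  show "x = (t + 2) div 2" if "k + 1 = ceil_halves (Suc t)"
  proof (rule ceil_halves_unique[OF assms(4,5)])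
    have "k - t = ceil_halves ((t + 2) div 2)"
      using that t assms(2) by linarith
    then show "ceil_halves ((t + 2) div 2) \<le> k - t" "k - t < ceil_halves (Suc ((t + 2) div 2))"
      using ceil_halves_less_Suc by simp_all
  qed
qed

text \<open>With \<open>t = tanny (n - 1)\<close>, the second summand of the recurrence is always
  \<open>(t + 1) div 2\<close> once \<open>n \<ge> 5\<close>. The first is the same inside the block
  of \<open>t\<close> and \<open>(t + 2) div 2\<close> at its end, so the sum is \<open>t\<close>,
  or \<open>Suc t\<close> exactly when a new block begins.\<close>

lemma tanny_ceil_halves:
  assumes "1 \<le> n"
  shows "ceil_halves (tanny n) \<le> n \<and> n < ceil_halves (Suc (tanny n))"
  using assms
proof (induction n rule: less_induct)
  case (less n)
  have n4: "ceil_halves (Suc 2) = 6"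
    by (metis ceil_halves_small(4) eval_nat_numeral(3))
  consider "n = 1" | "n = 2" | "n = 3" | "n = 4" | "n \<ge> 5"
    using less.prems by linarith
  then show ?case
  proof cases
    assume n: "n \<ge> 5"
    \<comment> \<open>The halving step requires values of at least 2; from \<open>n = 5\<close> on,
      both \<open>n - 1\<close> and \<open>n - 2\<close> are large enough for this.\<close>
    have ge2: "2 \<le> tanny k" if "3 \<le> k" "k < n" for k
    proof (rule ccontr)
      assume "\<not> 2 \<le> tanny k"
      then have "ceil_halves (Suc (tanny k)) \<le> ceil_halves 2"
        by (intro ceil_halves_mono) simp
      then show False
        using less.IH[of k] that by simp
    qed
    define t where "t = tanny (n - 1)"
    define u where "u = tanny (n - 2)"
    define x where "x = tanny (n - 1 - t)"
    define y where "y = tanny (n - 2 - u)"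
    have T: "tanny n = x + y"
      using tanny_rec[of n] n by (simp add: x_def y_def t_def u_def)
    have tu: "2 \<le> t" "2 \<le> u"
      using n by (auto simp: t_def u_def intro!: ge2)
    have t: "ceil_halves t \<le> n - 1" "n - 1 < ceil_halves (Suc t)"
      using less.IH[of "n - 1"] n by (auto simp: t_def)
    have u: "ceil_halves u \<le> n - 2" "n - 2 < ceil_halves (Suc u)"
      using less.IH[of "n - 2"] n by (auto simp: u_def)
    have pos: "1 \<le> n - 1 - t" "1 \<le> n - 2 - u"
    proof -
      have *: "m < ceil_halves m" if "2 \<le> m" for m
      proof -
        have "ceil_halves 1 \<le> ceil_halves ((m + 1) div 2)"
          using that by (intro ceil_halves_mono) linarith
        then show ?thesis
          using ceil_halves_rec[OF that] by simp
      qed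
      show "1 \<le> n - 1 - t" "1 \<le> n - 2 - u"
        using *[OF tu(1)] *[OF tu(2)] t u by linarith+
    qed
    have x: "ceil_halves x \<le> n - 1 - t" "n - 1 - t < ceil_halves (Suc x)"
      using less.IH[of "n - 1 - t"] n pos tu by (auto simp: x_def)
    have y: "ceil_halves y \<le> n - 2 - u" "n - 2 - u < ceil_halves (Suc y)"
      using less.IH[of "n - 2 - u"] n pos tu by (auto simp: y_def)
    \<comment> \<open>Either \<open>t = u\<close>, or \<open>n - 2\<close> ends the block of
      \<open>u\<close> and \<open>t = Suc u\<close>; the two cases of the halving lemma give the
      same number.\<close>
    have y': "y = (t + 1) div 2"
    proof (cases "n - 2 + 1 < ceil_halves (Suc u)")
      case True
      then have "t = u"
        using n t u by (intro ceil_halves_unique[of t "n - 1" u]) auto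
      then show ?thesis
        using ceil_halves_half(1)[OF tu(2) u y True] by simp
    next
      case False
      then have eq: "n - 2 + 1 = ceil_halves (Suc u)"
        using u by linarith
      then have "t = Suc u"
        using n t ceil_halves_less_Suc[of "Suc u"] by (intro ceil_halves_unique[of t "n - 1" "Suc u"]) auto
      then show ?thesis
        using ceil_halves_half(2)[OF tu(2) u y eq] by simp
    qed
    show ?thesis
    proof (cases "n - 1 + 1 < ceil_halves (Suc t)")
      case True
      \<comment> \<open>Two halves \<open>(t + 1) div 2\<close> add up to \<open>t\<close> only for
        even \<open>t\<close>. The block of an odd \<open>t \<ge> 3\<close> has a single index, so
        no step can stay inside it.\<close>
      have "even t"
      proof (rule ccontr)
        assume "odd t"
        then have "3 \<le> t"
          using tu by presburger
        then show False
          using ceil_halves_odd_gap[OF \<open>odd t\<close>] True t n by linarith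
      qed
      then have "x + y = t"
        using ceil_halves_half(1)[OF tu(1) t x True] y' by presburger
      then show ?thesis
        using T t True n by simp
    next
      case False
      then have eq: "n - 1 + 1 = ceil_halves (Suc t)"
        using t by linarith
      then have "x + y = Suc t"
        using ceil_halves_half(2)[OF tu(1) t x eq] y' by presburger
      then show ?thesis
        using T eq n ceil_halves_less_Suc[of "Suc t"] by simp
    qed
  qed (use n4 in \<open>simp_all add: tanny_small tanny_3 tanny_4 flip: numeral_2_eq_2\<close>)
qed

text \<open>Turns a lower bound on the size of a connected set into an upper bound on its leaves. It
  fails at index 0, where \<open>tanny\<close> is 1.\<close>

lemma le_tanny_iff:
  assumes "1 \<le> n"
  shows "m \<le> tanny n \<longleftrightarrow> ceil_halves m \<le> n"
proof
  assume "m \<le> tanny n"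
  then show "ceil_halves m \<le> n"
    using tanny_ceil_halves[OF assms] ceil_halves_mono[of m "tanny n"] by linarith
next
  assume "ceil_halves m \<le> n"
  then have "ceil_halves m < ceil_halves (Suc (tanny n))"
    using tanny_ceil_halves[OF assms] by linarith
  then show "m \<le> tanny n"
    by (simp add: strict_mono_less[OF strict_mono_ceil_halves])
qed

text \<open>The blocks are now open on the left, and \<open>d\<close> is the sequence value minus
  one: the argument \<open>n - conolly (n - 1)\<close> of the recurrence is
  \<open>(n - 1) - d\<close>.\<close>

lemma floor_halves_half:
  assumes "floor_halves d < k" "k \<le> floor_halves (Suc d)"
    and "floor_halves x < k - d" "k - d \<le> floor_halves (Suc x)"
  shows "k < floor_halves (Suc d) \<Longrightarrow> x = d div 2"
    and "k = floor_halves (Suc d) \<Longrightarrow> x = Suc d div 2"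
proof -
  have d: "floor_halves d = d + floor_halves (d div 2)"
    "floor_halves (Suc d) = Suc d + floor_halves (Suc d div 2)"
    by (rule floor_halves_rec)+
  have half: "Suc d div 2 \<le> Suc (d div 2)"
    by presburger
  show "x = d div 2" if "k < floor_halves (Suc d)"
  proof (rule floor_halves_unique[OF assms(3,4)])
    show "floor_halves (d div 2) < k - d"
      using assms(1) d by linarith
    have "k - d \<le> floor_halves (Suc d div 2)"
      using that d by linarith
    also have "\<dots> \<le> floor_halves (Suc (d div 2))"
      by (rule floor_halves_mono[OF half])
    finally show "k - d \<le> floor_halves (Suc (d div 2))" .
  qed
  show "x = Suc d div 2" if "k = floor_halves (Suc d)"
  proof (rule floor_halves_unique[OF assms(3,4)])
    have "k - d = Suc (floor_halves (Suc d div 2))"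
      using that d by linarith
    then show "floor_halves (Suc d div 2) < k - d" "k - d \<le> floor_halves (Suc (Suc d div 2))"
      using floor_halves_less_Suc[of "Suc d div 2"] by simp_all
  qed
qed

section \<open>The Conolly recurrence\<close>

lemma conolly_rec:
  "n > 2 \<Longrightarrow> conolly n = conolly (n - conolly (n - 1)) + conolly (n - 1 - conolly (n - 2))"
  by (subst conolly.simps) simp

text \<open>As for the Tanny sequence, with floors. Inside a block both summands are
  \<open>Suc (t div 2)\<close>, which happens only for odd \<open>t\<close> and gives
  \<open>Suc t\<close>; at its end the first becomes \<open>Suc (Suc t div 2)\<close>, which starts
  the next block.\<close>

lemma conolly_floor_halves:
  assumes "1 \<le> n"
  shows "\<exists>c. conolly n = Suc c \<and> floor_halves c < n \<and> n \<le> floor_halves (Suc c)"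
  using assms
proof (induction n rule: less_induct)
  case (less n)
  have small: "floor_halves 1 = 1" "floor_halves 2 = 3"
    by (simp_all add: floor_halves.simps)
  consider "n = 1" | "n = 2" | "n \<ge> 3"
    using less.prems by linarith
  then show ?case
  proof cases
    assume n: "n \<ge> 3"
    have pred: "\<exists>c. conolly k = Suc c \<and> floor_halves c < k \<and> k \<le> floor_halves (Suc c)"
      if "1 \<le> k" "k < n" for k
      using less.IH that by blast
    have bnd: "1 \<le> n - 1" "n - 1 < n" "1 \<le> n - 2" "n - 2 < n"
      using n by simp_all
    obtain t where t0: "conolly (n - 1) = Suc t"
      and t: "floor_halves t < n - 1" "n - 1 \<le> floor_halves (Suc t)"
      using pred[OF bnd(1,2)] by blast
    obtain u where u0: "conolly (n - 2) = Suc u"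
      and u: "floor_halves u < n - 2" "n - 2 \<le> floor_halves (Suc u)"
      using pred[OF bnd(3,4)] by blast
    have ix: "n - Suc t = n - 1 - t" "n - 1 - Suc u = n - 2 - u" by simp_all
    have pos: "1 \<le> n - 1 - t" "1 \<le> n - 2 - u"
      using t u floor_halves_rec[of t] floor_halves_rec[of u] by linarith+
    obtain x where x0: "conolly (n - 1 - t) = Suc x"
      and x: "floor_halves x < n - 1 - t" "n - 1 - t \<le> floor_halves (Suc x)"
      using pred[OF pos(1)] n by fastforce
    obtain y where y0: "conolly (n - 2 - u) = Suc y"
      and y: "floor_halves y < n - 2 - u" "n - 2 - u \<le> floor_halves (Suc y)"
      using pred[OF pos(2)] n by fastforce
    have C: "conolly n = Suc (Suc (x + y))"
      using conolly_rec[of n] n by (simp only: t0 u0 ix x0 y0)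
    have y': "y = t div 2"
    proof (cases "n - 2 < floor_halves (Suc u)")
      case True
      then have "t = u"
        using n t u by (intro floor_halves_unique[of t "n - 1" u]) auto
      then show ?thesis
        using floor_halves_half(1)[OF u y True] by simp
    next
      case False
      then have eq: "n - 2 = floor_halves (Suc u)"
        using u by linarith
      then have "t = Suc u"
        using n t floor_halves_less_Suc[of "Suc u"] by (intro floor_halves_unique[of t "n - 1" "Suc u"]) auto
      then show ?thesis
        using floor_halves_half(2)[OF u y eq] by simp
    qed
    show ?thesis
    proof (cases "n - 1 < floor_halves (Suc t)")
      case True
      have "odd t"
      proof
        assume "even t"
        then show False
          using floor_halves_even_gap True t by fastforce
      qed
      then have "Suc (x + y) = t"
        using floor_halves_half(1)[OF t x True] y' by presburger
      then show ?thesis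
        using C t True by auto
    next
      case False
      then have eq: "n - 1 = floor_halves (Suc t)"
        using t by linarith
      then have "x + y = t"
        using floor_halves_half(2)[OF t x eq] y' by presburger
      then show ?thesis
        using C eq n floor_halves_less_Suc[of "Suc t"] by auto
    qed
  qed (use small in \<open>simp_all add: conolly.simps flip: numeral_2_eq_2\<close>)
qed

text \<open>Turns an upper bound on the size of a closed set into a lower bound on its
  leaves.\<close>

lemma conolly_le_iff: "conolly n \<le> q \<longleftrightarrow> n \<le> floor_halves q"
proof (cases "n = 0")
  case True
  then show ?thesis using conolly_bounds(2)[of 0] by simp
next
  case False
  then obtain c where c: "conolly n = Suc c" "floor_halves c < n" "n \<le> floor_halves (Suc c)"
    using conolly_floor_halves[of n] by auto
  show ?thesis
  proof
    assume "conolly n \<le> q"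
    then show "n \<le> floor_halves q"
      using c floor_halves_mono[of "Suc c" q] by linarith
  next
    assume "n \<le> floor_halves q"
    then have "floor_halves c < floor_halves q"
      using c by linarith
    then show "conolly n \<le> q"
      using c by (simp add: strict_mono_less[OF strict_mono_floor_halves])
  qed
qed

lemma conolly_subadd: "conolly (u + v) \<le> conolly u + conolly v"
proof -
  have "u + v \<le> floor_halves (conolly u) + floor_halves (conolly v)"
    using conolly_le_iff by (intro add_mono) blast+
  then show ?thesis
    unfolding conolly_le_iff using floor_halves_superadd[of "conolly u" "conolly v"] by linarith
qed

text \<open>
  Two connected sets with \<open>m\<close> and \<open>k\<close> leaves can be traded for a full subtree with \<open>2 ^ h\<close>
  leaves and a connected set with the remaining leaves.
\<close>

lemma ceil_halves_exchange:
  assumes "k \<le> m" "k \<le> 2 ^ h" "2 ^ h < 2 * k"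
  shows "ceil_halves (2 ^ h) + ceil_halves (m + k - 2 ^ h) \<le> ceil_halves m + ceil_halves k"
  using assms
proof (induction h arbitrary: m k)
  case 0
  then have "k = 1" by simp
  then show ?case by simp
next
  case (Suc h)
  define P :: nat where "P = 2 ^ h"
  have P: "1 \<le> P" "2 ^ Suc h = 2 * P" by (simp_all add: P_def)
  have k: "k \<le> m" "k \<le> 2 * P" "P < k"
    using Suc.prems P by simp_all
  \<comment> \<open>Halving \<open>m\<close>, \<open>k\<close> and the power of two together
    preserves the hypotheses. As rounding up is subadditive, half of the remainder
    \<open>m + k - 2 * P\<close>, rounded up, is at most \<open>m' + k' - P\<close>.\<close>
  define m' where "m' = (m + 1) div 2"
  define k' where "k' = (k + 1) div 2"
  have k': "k' \<le> m'" "k' \<le> P" "P < 2 * k'"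
    using k by (auto simp: m'_def k'_def)
  have IH: "ceil_halves P + ceil_halves (m' + k' - P) \<le> ceil_halves m' + ceil_halves k'"
    using Suc.IH[of k' m'] k' by (simp add: P_def)
  have "ceil_halves (m + k - 2 * P) \<le> (m + k - 2 * P) + ceil_halves ((m + k - 2 * P + 1) div 2)"
    by (rule ceil_halves_le_rec)
  also have "ceil_halves ((m + k - 2 * P + 1) div 2) \<le> ceil_halves (m' + k' - P)"
    using k k' by (intro ceil_halves_mono) (simp add: m'_def k'_def)
  finally have "ceil_halves (m + k - 2 * P) \<le> (m + k - 2 * P) + ceil_halves (m' + k' - P)"
    by simp
  moreover have "ceil_halves (2 * P) = 2 * P + ceil_halves P"
    using ceil_halves_rec[of "2 * P"] P by simp
  moreover have "ceil_halves m = m + ceil_halves m'" "ceil_halves k = k + ceil_halves k'"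
    using ceil_halves_rec[of m] ceil_halves_rec[of k] k P by (simp_all add: m'_def k'_def)
  ultimately show ?case
    unfolding P(2) using IH k by linarith
qed

lemma ex_power2_between:
  assumes "1 \<le> (k::nat)"
  shows "\<exists>h. k \<le> 2 ^ h \<and> 2 ^ h < 2 * k"
proof -
  define h where "h = (LEAST h. k \<le> 2 ^ h)"
  have "k \<le> 2 ^ k" by (simp add: less_imp_le)
  then have h: "k \<le> 2 ^ h"
    unfolding h_def by (rule LeastI)
  moreover have "2 ^ h < 2 * k"
  proof (cases h)
    case 0
    then show ?thesis using assms by simp
  next
    case (Suc l)
    then have "\<not> k \<le> 2 ^ l"
      using not_less_Least[of l "\<lambda>h. k \<le> 2 ^ h"] by (simp add: h_def)
    then show ?thesis using Suc by simp
  qed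
  ultimately show ?thesis by blast
qed

text \<open>Compares scores (leaves minus components): two connected sets of sizes \<open>a\<close>
  and \<open>b\<close> do no better than a closed set of size \<open>w\<close> with one connected
  set on the other \<open>a + b - w\<close> vertices.\<close>

lemma tanny_exchange:
  assumes "1 \<le> a" "1 \<le> b"
  shows "\<exists>w \<le> a + b. tanny a + tanny b + conolly w \<le> 1 + w + tanny (a + b - w)"
proof -
  have *: "\<exists>w \<le> a + b. tanny a + tanny b + conolly w \<le> 1 + w + tanny (a + b - w)"
    if le: "tanny b \<le> tanny a" and ab: "1 \<le> a" "1 \<le> b" for a b
  proof -
    define m where "m = tanny a"
    define k where "k = tanny b"
    have k: "1 \<le> k" "k \<le> m"
      using tanny_bounds le by (auto simp: m_def k_def)
    \<comment> \<open>\<open>k\<close> is the smaller leaf count. The upper bound keeps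
      \<open>2 ^ h\<close> below \<open>m + k\<close>, so the remaining connected set still has a
      leaf.\<close>
    obtain h where h: "k \<le> 2 ^ h" "2 ^ h < 2 * k"
      using ex_power2_between[OF k(1)] by blast
    define w :: nat where "w = 2 ^ Suc h - 1"
    have w: "w = ceil_halves (2 ^ h)" "w = floor_halves (2 ^ h)" "w + 1 = 2 * 2 ^ h"
      by (simp_all add: w_def ceil_halves_power floor_halves_power)
    have "ceil_halves m \<le> a" "ceil_halves k \<le> b"
      using le_tanny_iff ab by (auto simp: m_def k_def)
    then have le: "w + ceil_halves (m + k - 2 ^ h) \<le> a + b"
      using ceil_halves_exchange[OF k(2) h] w(1) by linarith
    have "1 \<le> m + k - 2 ^ h"
      using h k by linarith
    then have "1 \<le> ceil_halves (m + k - 2 ^ h)"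
      using ceil_halves_mono by fastforce
    then have "m + k - 2 ^ h \<le> tanny (a + b - w)"
      using le le_tanny_iff[of "a + b - w"] by simp
    moreover have "conolly w \<le> 2 ^ h"
      by (simp add: conolly_le_iff w(2))
    ultimately have "m + k + conolly w \<le> 1 + w + tanny (a + b - w)"
      using w(3) by linarith
    then show ?thesis
      using le by (auto simp: m_def k_def intro!: exI[of _ w])
  qed
  show ?thesis
  proof (cases "tanny b \<le> tanny a")
    case True
    then show ?thesis using *[OF True assms] by simp
  next
    case False
    then show ?thesis using *[of a b] assms by (simp add: add.commute)
  qed
qed


section \<open>Descendants and connectedness\<close>

definition descendants :: "nat \<times> nat \<Rightarrow> (nat \<times> nat) set" where
  "descendants w = {v. \<exists>k. (parent ^^ k) v = w}"

lemma parent_pow: "(parent ^^ k) v = (fst v + k, snd v div 2 ^ k)"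
  by (induction k) (simp_all add: parent_def mult.commute flip: div_mult2_eq)

lemma fst_parent [simp]: "fst (parent v) = Suc (fst v)"
  by (simp add: parent_def)

lemma self_in_descendants [simp]: "v \<in> descendants v"
  by (auto simp: descendants_def intro: exI[of _ 0])

lemma parent_in_descendantsD: "parent v \<in> descendants w \<Longrightarrow> v \<in> descendants w"
  by (auto simp: descendants_def simp flip: funpow_swap1 intro: exI[of _ "Suc _"])

lemma descendants_parentI:
  assumes "v \<in> descendants w" "v \<noteq> w"
  shows "parent v \<in> descendants w"
proof -
  obtain k where k: "(parent ^^ k) v = w"
    using assms by (auto simp: descendants_def)
  then obtain l where "k = Suc l"
    using assms(2) by (cases k) auto
  then have "(parent ^^ l) (parent v) = w"
    using k by (simp add: funpow_swap1)
  then show ?thesis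
    by (auto simp: descendants_def)
qed

lemma descendants_levelD:
  assumes "v \<in> descendants w"
  shows "fst v \<le> fst w" "fst v = fst w \<Longrightarrow> v = w"
proof -
  obtain k where k: "w = (fst v + k, snd v div 2 ^ k)"
    using assms by (auto simp: descendants_def parent_pow)
  then show "fst v \<le> fst w"
    by (metis fst_conv le_add1)
  show "v = w" if "fst v = fst w"
    using k that by (metis add_cancel_right_right div_by_1 fst_conv power_0 prod.collapse)
qed

lemma verts_T_inf: "v \<in> verts T_inf \<longleftrightarrow> 1 \<le> fst v"
  by (cases v) (simp add: T_inf_def)

lemma parcs_mk_symmetric_T_inf:
  "(u, v) \<in> parcs (mk_symmetric (T_inf \<restriction> X)) \<longleftrightarrow>
     u \<in> X \<and> v \<in> X \<and> (v = parent u \<and> 1 \<le> fst u \<or> u = parent v \<and> 1 \<le> fst v)"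
proof -
  have arcs: "arcs (T_inf \<restriction> X) = (\<lambda>v. (v, parent v)) ` {v \<in> X. parent v \<in> X \<and> 1 \<le> fst v}"
    by (auto simp: T_inf_def)
  have ends: "tail (T_inf \<restriction> X) = fst" "head (T_inf \<restriction> X) = snd"
    by (simp_all add: T_inf_def)
  show ?thesis
    unfolding parcs_mk_symmetric arcs ends by (auto simp del: split_paired_Ex)
qed

text \<open>A path can leave the subtree below \<open>w\<close> only along the edge to
  \<open>parent w\<close>.\<close>

lemma connected_subset_descendants:
  assumes "connected (T_inf \<restriction> X)" "w \<in> X" "parent w \<notin> X"
  shows "X \<subseteq> descendants w"
proof
  fix v assume "v \<in> X"
  let ?G = "with_proj (mk_symmetric (T_inf \<restriction> X))"
  have "w \<rightarrow>\<^sup>*\<^bsub>?G\<^esub> v"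
    using assms(1,2) \<open>v \<in> X\<close> by (auto simp: connected_def strongly_connected_def)
  then show "v \<in> descendants w"
    unfolding reachable_def
  proof (induction rule: rtrancl_on_induct)
    case (step x y)
    then show ?case
      using assms(3) descendants_parentI[of x w] parent_in_descendantsD[of y w]
      by (auto simp: parcs_mk_symmetric_T_inf)
  qed simp
qed

lemma reachable_parent_pow:
  assumes "X \<subseteq> verts T_inf" "\<And>l. l \<le> k \<Longrightarrow> (parent ^^ l) v \<in> X"
  shows "v \<rightarrow>\<^sup>*\<^bsub>with_proj (mk_symmetric (T_inf \<restriction> X))\<^esub> (parent ^^ k) v"
  using assms(2)
proof (induction k)
  case 0
  then have "v \<in> X" using 0[of 0] by simp
  then show ?case by (simp add: reachable_def)
next
  case (Suc k)
  have "(parent ^^ k) v \<in> X" "parent ((parent ^^ k) v) \<in> X"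
    using Suc.prems[of k] Suc.prems[of "Suc k"] by simp_all
  then have "(parent ^^ k) v \<rightarrow>\<^bsub>with_proj (mk_symmetric (T_inf \<restriction> X))\<^esub> (parent ^^ Suc k) v"
    using assms(1) by (auto simp: parcs_mk_symmetric_T_inf verts_T_inf)
  moreover have "v \<rightarrow>\<^sup>*\<^bsub>with_proj (mk_symmetric (T_inf \<restriction> X))\<^esub> (parent ^^ k) v"
    using Suc by simp
  ultimately show ?case
    by (auto simp: reachable_def intro: rtrancl_on_into_rtrancl_on \<open>parent ((parent ^^ k) v) \<in> X\<close>)
qed

lemma connectedI_common_ancestor:
  assumes "X \<subseteq> verts T_inf" "X \<noteq> {}"
    and "\<And>u v. u \<in> X \<Longrightarrow> v \<in> X \<Longrightarrow> \<exists>k l. (parent ^^ k) u = (parent ^^ l) v \<and>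
           (\<forall>i \<le> k. (parent ^^ i) u \<in> X) \<and> (\<forall>i \<le> l. (parent ^^ i) v \<in> X)"
  shows "connected (T_inf \<restriction> X)"
  unfolding connected_def strongly_connected_def
proof (intro conjI ballI)
  let ?G = "with_proj (mk_symmetric (T_inf \<restriction> X))"
  show "verts ?G \<noteq> {}"
    using assms(2) by simp
  fix u v assume "u \<in> verts ?G" "v \<in> verts ?G"
  then obtain k l where kl: "(parent ^^ k) u = (parent ^^ l) v"
    "\<forall>i \<le> k. (parent ^^ i) u \<in> X" "\<forall>i \<le> l. (parent ^^ i) v \<in> X"
    using assms(3)[of u v] by auto
  have "u \<rightarrow>\<^sup>*\<^bsub>?G\<^esub> (parent ^^ k) u"
    using kl by (intro reachable_parent_pow assms(1)) auto
  moreover have "v \<rightarrow>\<^sup>*\<^bsub>?G\<^esub> (parent ^^ l) v"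
    using kl by (intro reachable_parent_pow assms(1)) auto
  then have "(parent ^^ l) v \<rightarrow>\<^sup>*\<^bsub>?G\<^esub> v"
    by (rule symmetric_reachable[OF symmetric_mk_symmetric])
  ultimately show "u \<rightarrow>\<^sup>*\<^bsub>?G\<^esub> v"
    using kl(1) unfolding reachable_def by (auto intro: rtrancl_on_trans)
qed

lemma connected_parent_closed:
  assumes "X \<subseteq> verts T_inf" "X \<noteq> {}" "\<And>v. v \<in> X \<Longrightarrow> parent v \<in> X"
  shows "connected (T_inf \<restriction> X)"
proof (rule connectedI_common_ancestor[OF assms(1,2)])
  fix u v assume uv: "u \<in> X" "v \<in> X"
  have closed: "(parent ^^ i) x \<in> X" if "x \<in> X" for x i
    by (induction i) (use that assms(3) in auto)
  \<comment> \<open>At level \<open>K\<close> each of the two vertices has climbed at least as many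
    steps as its second coordinate, which halving has then reduced to 0.\<close>
  define K where "K = fst u + snd u + fst v + snd v"
  have anc: "(parent ^^ (K - fst x)) x = (K, 0)" if "fst x + snd x \<le> K" for x
  proof -
    have "snd x < 2 ^ snd x" by simp
    also have "(2::nat) ^ snd x \<le> 2 ^ (K - fst x)"
      using that by (intro power_increasing) auto
    finally show ?thesis
      using that by (simp add: parent_pow)
  qed
  have "(parent ^^ (K - fst u)) u = (parent ^^ (K - fst v)) v"
    using anc[of u] anc[of v] by (simp add: K_def)
  then show "\<exists>k l. (parent ^^ k) u = (parent ^^ l) v \<and>
      (\<forall>i \<le> k. (parent ^^ i) u \<in> X) \<and> (\<forall>i \<le> l. (parent ^^ i) v \<in> X)"
    using closed uv by blast
qed

lemma connected_rooted:
  assumes "X \<subseteq> verts T_inf" "r \<in> X"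
    and "\<And>v. v \<in> X \<Longrightarrow> v \<noteq> r \<Longrightarrow> parent v \<in> X \<and> fst v < fst r"
  shows "connected (T_inf \<restriction> X)"
proof (rule connectedI_common_ancestor[OF assms(1)])
  show "X \<noteq> {}" using assms(2) by blast
  have "\<exists>k. (parent ^^ k) v = r \<and> (\<forall>i \<le> k. (parent ^^ i) v \<in> X)" if "v \<in> X" for v
    using that
  \<comment> \<open>Until \<open>r\<close> is met the level stays below that of \<open>r\<close> and
    rises with each step, so the climb must end at \<open>r\<close>.\<close>
  proof (induction "fst r - fst v" arbitrary: v rule: less_induct)
    case less
    show ?case
    proof (cases "v = r")
      case True
      then show ?thesis using less.prems by (intro exI[of _ 0]) simp
    next
      case False
      then have p: "parent v \<in> X" "fst v < fst r"
        using assms(3) less.prems by auto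
      then obtain k where k: "(parent ^^ k) (parent v) = r" "\<forall>i \<le> k. (parent ^^ i) (parent v) \<in> X"
        using less.hyps[of "parent v"] diff_less_mono2[of "fst v" "Suc (fst v)" "fst r"] by force
      have "(parent ^^ i) v \<in> X" if "i \<le> Suc k" for i
        using that k(2) less.prems by (cases i) (auto simp: funpow_Suc_right simp del: funpow.simps(2))
      then show ?thesis
        using k(1) by (intro exI[of _ "Suc k"]) (simp add: funpow_Suc_right del: funpow.simps(2))
    qed
  qed
  then show "\<exists>k l. (parent ^^ k) u = (parent ^^ l) v \<and>
      (\<forall>i \<le> k. (parent ^^ i) u \<in> X) \<and> (\<forall>i \<le> l. (parent ^^ i) v \<in> X)"
    if "u \<in> X" "v \<in> X" for u v
    using that by metis
qed

lemma obtain_max_level: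
  assumes "finite S" "S \<noteq> {}"
  obtains r :: "nat \<times> nat" where "r \<in> S" "\<And>v. v \<in> S \<Longrightarrow> fst v \<le> fst r"
proof -
  have "Max (fst ` S) \<in> fst ` S"
    using assms by (intro Max_in) auto
  then obtain r where "r \<in> S" "fst r = Max (fst ` S)"
    by auto
  then show ?thesis
    using assms that[of r] by (metis Max_ge finite_imageI imageI)
qed

text \<open>Take \<open>r\<close> of highest level. If another vertex had its parent outside, the
  whole set, and so \<open>r\<close>, would lie below that vertex.\<close>

lemma connected_imp_rooted:
  assumes "finite S" "connected (T_inf \<restriction> S)"
  obtains r where "r \<in> S" "\<And>v. v \<in> S \<Longrightarrow> v \<noteq> r \<Longrightarrow> parent v \<in> S"
proof -
  have "S \<noteq> {}"
    using assms(2) by (auto simp: connected_def strongly_connected_def)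
  then obtain r where r: "r \<in> S" "\<And>v. v \<in> S \<Longrightarrow> fst v \<le> fst r"
    using obtain_max_level[OF assms(1)] by metis
  show ?thesis
  proof (rule that[OF r(1)])
    fix v assume v: "v \<in> S" "v \<noteq> r"
    show "parent v \<in> S"
    proof (rule ccontr)
      assume "parent v \<notin> S"
      then have "r \<in> descendants v"
        using connected_subset_descendants[OF assms(2) v(1)] r(1) by blast
      then show False
        using descendants_levelD[of r v] r(2)[OF v(1)] v(2) by auto
    qed
  qed
qed

text \<open>Otherwise the complement would be confined to the subtree below \<open>v\<close>,
  although it contains vertices of arbitrarily high level.\<close>

lemma connected_complement_imp_closed:
  assumes "finite S" "connected (T_inf \<restriction> (verts T_inf - S))" "parent v \<in> S" "1 \<le> fst v"
  shows "v \<in> S"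
proof (rule ccontr)
  assume "v \<notin> S"
  then have sub: "verts T_inf - S \<subseteq> descendants v"
    using assms by (intro connected_subset_descendants) (auto simp: verts_T_inf)
  have "finite (insert (fst v) (fst ` S))"
    using assms(1) by simp
  then obtain K where K: "\<And>x. x \<in> insert (fst v) (fst ` S) \<Longrightarrow> x \<le> K"
    by (meson finite_nat_set_iff_bounded_le)
  have "(Suc K, 0) \<notin> S"
    using K[of "Suc K"] by force
  then have "(Suc K, 0) \<in> descendants v"
    using sub by (auto simp: verts_T_inf)
  then show False
    using descendants_levelD(1) K[of "fst v"] by fastforce
qed


section \<open>The boundary in terms of leaves and roots\<close>

definition leaves :: "(nat \<times> nat) set \<Rightarrow> (nat \<times> nat) set" where
  "leaves S = {v \<in> S. fst v = 1}"

text \<open>Each component of a finite set has exactly one such vertex, so components are counted by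
  counting roots.\<close>

definition roots :: "(nat \<times> nat) set \<Rightarrow> (nat \<times> nat) set" where
  "roots S = {v \<in> S. parent v \<notin> S}"

definition children :: "(nat \<times> nat) set \<Rightarrow> (nat \<times> nat) set" where
  "children S = {v. 1 \<le> fst v \<and> parent v \<in> S}"

lemma children_eq_image:
  assumes "S \<subseteq> verts T_inf"
  shows "children S = (\<lambda>(u, b). (fst u - 1, 2 * snd u + b)) ` ((S - leaves S) \<times> {0, 1})"
proof (intro equalityI subsetI)
  fix v assume v: "v \<in> children S"
  have "v = (\<lambda>(u, b). (fst u - 1, 2 * snd u + b)) (parent v, snd v mod 2)"
    by (simp add: parent_def prod_eq_iff)
  moreover have "parent v \<in> S - leaves S" "snd v mod 2 \<in> {0, 1}"
    using v by (auto simp: children_def leaves_def)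
  ultimately show "v \<in> (\<lambda>(u, b). (fst u - 1, 2 * snd u + b)) ` ((S - leaves S) \<times> {0, 1})"
    by (metis (no_types, lifting) SigmaI imageI)
next
  fix v assume "v \<in> (\<lambda>(u, b). (fst u - 1, 2 * snd u + b)) ` ((S - leaves S) \<times> {0, 1})"
  then obtain u b where u: "u \<in> S" "fst u \<noteq> 1" "b \<in> {0, 1}" "v = (fst u - 1, 2 * snd u + b)"
    by (auto simp: leaves_def)
  then have "parent v = u" "1 \<le> fst v"
    using assms verts_T_inf[of u] by (auto simp: parent_def prod_eq_iff)
  then show "v \<in> children S"
    using u by (simp add: children_def)
qed

lemma finite_children: "finite S \<Longrightarrow> S \<subseteq> verts T_inf \<Longrightarrow> finite (children S)"
  by (simp add: children_eq_image)

lemma card_children: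
  assumes "finite S" "S \<subseteq> verts T_inf"
  shows "card (children S) = 2 * card (S - leaves S)"
proof -
  have "inj_on (\<lambda>(u, b). (fst u - 1, 2 * snd u + b)) ((S - leaves S) \<times> {0, 1::nat})"
  proof (rule inj_onI, clarsimp)
    fix i j b i' j' b' :: nat
    assume *: "(i, j) \<in> S" "(i', j') \<in> S" "i - Suc 0 = i' - Suc 0" "2 * j + b = 2 * j' + b'"
      "b = 0 \<or> b = Suc 0" "b' = 0 \<or> b' = Suc 0"
    have "1 \<le> i" "1 \<le> i'"
      using subsetD[OF assms(2) *(1)] subsetD[OF assms(2) *(2)] by (simp_all add: verts_T_inf)
    then show "i = i' \<and> j = j' \<and> b = b'"
      using *(3-6) by presburger
  qed
  then show ?thesis
    using assms by (simp add: children_eq_image card_image)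
qed

text \<open>Boundary edges lead up from the roots or down to children outside \<open>S\<close>. The
  latter are counted through all children: two for each non-leaf, and those inside \<open>S\<close>
  are exactly the non-roots.\<close>

lemma card_edge_boundary:
  assumes "finite S" "S \<subseteq> verts T_inf"
  shows "card (edge_boundary S) + 2 * card (leaves S) = card S + 2 * card (roots S)"
proof -
  have eq: "edge_boundary S = (\<lambda>v. (v, parent v)) ` (roots S \<union> (children S - S))"
  proof -
    have arcs: "arcs T_inf = (\<lambda>v. (v, parent v)) ` {v. 1 \<le> fst v}"
      and ends: "tail T_inf = fst" "head T_inf = snd"
      by (auto simp: T_inf_def)
    have pos: "1 \<le> fst v" if "v \<in> S" for v
      using that assms(2) verts_T_inf by blast
    show ?thesis
      unfolding edge_boundary_def arcs ends
      by (auto simp: roots_def children_def verts_T_inf simp del: split_paired_Ex dest: pos)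
  qed
  have fin: "finite (roots S)" "finite (leaves S)" "finite (children S)"
    using assms by (simp_all add: roots_def leaves_def finite_children)
  have "card (edge_boundary S) = card (roots S \<union> (children S - S))"
    unfolding eq by (intro card_image inj_onI) simp
  also have "\<dots> = card (roots S) + card (children S - S)"
    using fin by (intro card_Un_disjoint) (auto simp: roots_def)
  finally have b: "card (edge_boundary S) = card (roots S) + card (children S - S)" .
  have "children S = (children S - S) \<union> (S - roots S)"
    using assms(2) verts_T_inf by (auto simp: children_def roots_def)
  then have "card (children S) = card (children S - S) + card (S - roots S)"
    using fin assms(1) card_Un_disjoint[of "children S - S" "S - roots S"] by auto
  moreover have "card (S - roots S) + card (roots S) = card S"
    "card (S - leaves S) + card (leaves S) = card S"
    using assms(1) by (auto simp: roots_def leaves_def card_Diff_subset card_mono)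
  ultimately show ?thesis
    using b card_children[OF assms] by linarith
qed


section \<open>Sizes of rooted and of closed sets\<close>

lemma finite_leaves [simp]: "finite S \<Longrightarrow> finite (leaves S)"
  by (simp add: leaves_def)

lemma finite_roots [simp]: "finite S \<Longrightarrow> finite (roots S)"
  by (simp add: roots_def)

lemma card_from_level:
  assumes "finite (S :: (nat \<times> nat) set)"
  shows "card {v \<in> S. i \<le> fst v} = card {v \<in> S. fst v = i} + card {v \<in> S. Suc i \<le> fst v}"
proof -
  have "{v \<in> S. i \<le> fst v} = {v \<in> S. fst v = i} \<union> {v \<in> S. Suc i \<le> fst v}"
    by auto
  then show ?thesis
    using assms by (simp add: card_Un_disjoint disjoint_iff)
qed

lemma rooted_ceil_halves_leaves:
  assumes "finite S" "S \<subseteq> verts T_inf" "r \<in> S"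
    and "\<And>v. v \<in> S \<Longrightarrow> v \<noteq> r \<Longrightarrow> parent v \<in> S"
  shows "ceil_halves (card (leaves S)) \<le> card S"
proof -
  obtain t where t: "t \<in> S" "\<And>v. v \<in> S \<Longrightarrow> fst v \<le> fst t"
    using obtain_max_level[OF assms(1)] assms(3) by blast
  \<comment> \<open>Induction from the top row downwards; the claim at level 1 is the goal.\<close>
  have level: "ceil_halves (card {v \<in> S. fst v = i}) \<le> card {v \<in> S. i \<le> fst v}" for i
  proof (induction "Suc (fst t) - i" arbitrary: i)
    case 0
    then have "{v \<in> S. fst v = i} = {}"
      using t(2) by fastforce
    then show ?case
      by (simp only: card.empty ceil_halves_small)
  next
    case (Suc k)
    define s where "s = card {v \<in> S. fst v = i}"
    define s' where "s' = card {v \<in> S. fst v = Suc i}"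
    have up: "card {v \<in> S. i \<le> fst v} = s + card {v \<in> S. Suc i \<le> fst v}"
      unfolding s_def by (rule card_from_level[OF assms(1)])
    show ?case
    proof (cases "s \<le> 1")
      case True
      then have "ceil_halves s = s" by (simp add: ceil_halves.simps)
      then show ?thesis using up s_def by simp
    next
      case False
      have "t = r"
        using t(2)[of "parent t"] assms(4)[OF t(1)] by (cases "t = r") auto
      \<comment> \<open>\<open>r\<close> has the highest level, so a second vertex in its row would
        have a parent in \<open>S\<close> above \<open>r\<close>. Hence all vertices of a row with
        at least two have their parents in the next row.\<close>
      have "r \<notin> {v \<in> S. fst v = i}"
      proof
        assume "r \<in> {v \<in> S. fst v = i}"
        then have "v = r" if "v \<in> {v \<in> S. fst v = i}" for v
          using that t(2)[of "parent v"] assms(4)[of v] \<open>t = r\<close> by auto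
        then have "{v \<in> S. fst v = i} \<subseteq> {r}"
          by blast
        then have "s \<le> 1"
          unfolding s_def using card_mono[of "{r}"] by fastforce
        then show False using False by simp
      qed
      then have "{v \<in> S. fst v = i} \<subseteq> children {v \<in> S. fst v = Suc i}"
        using assms(2,4) verts_T_inf by (auto simp: children_def simp del: split_paired_All)
      then have "s \<le> card (children {v \<in> S. fst v = Suc i})"
        unfolding s_def using assms(1,2) by (intro card_mono finite_children) auto
      also have "\<dots> = 2 * card ({v \<in> S. fst v = Suc i} - leaves {v \<in> S. fst v = Suc i})"
        using assms(1,2) by (intro card_children) auto
      also have "\<dots> \<le> 2 * s'"
        unfolding s'_def using assms(1) by (intro mult_le_mono2 card_mono) auto
      finally have "(s + 1) div 2 \<le> s'" by linarith
      then have "ceil_halves ((s + 1) div 2) \<le> ceil_halves s'"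
        by (rule ceil_halves_mono)
      also have "\<dots> \<le> card {v \<in> S. Suc i \<le> fst v}"
        unfolding s'_def using Suc.hyps(2) by (intro Suc.hyps(1)) linarith
      finally show ?thesis
        using up ceil_halves_rec[of s] False by (simp add: s_def)
    qed
  qed
  have "{v \<in> S. 1 \<le> fst v} = S"
    using assms(2) verts_T_inf by auto
  then show ?thesis
    using level[of 1] by (simp add: leaves_def)
qed

lemma rooted_leaves_le_tanny:
  assumes "finite S" "S \<subseteq> verts T_inf" "r \<in> S"
    and "\<And>v. v \<in> S \<Longrightarrow> v \<noteq> r \<Longrightarrow> parent v \<in> S"
  shows "card (leaves S) \<le> tanny (card S)"
proof -
  have "1 \<le> card S"
    using assms(1,3) by (metis One_nat_def Suc_leI card_gt_0_iff empty_iff)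
  then show ?thesis
    using rooted_ceil_halves_leaves[OF assms] by (simp add: le_tanny_iff)
qed

lemma closed_card_le_floor_halves_leaves:
  assumes "finite S" "S \<subseteq> verts T_inf" "\<And>v. 1 \<le> fst v \<Longrightarrow> parent v \<in> S \<Longrightarrow> v \<in> S"
  shows "card S \<le> floor_halves (card (leaves S))"
proof (cases "S = {}")
  case False
  obtain t where t: "t \<in> S" "\<And>v. v \<in> S \<Longrightarrow> fst v \<le> fst t"
    using obtain_max_level[OF assms(1) False] by blast
  \<comment> \<open>Each vertex of row \<open>Suc i\<close> brings two children into row
    \<open>i\<close>. Row 0 is empty, so the bound has to stop at level 1.\<close>
  have level: "card {v \<in> S. i \<le> fst v} \<le> floor_halves (card {v \<in> S. fst v = i})" if "1 \<le> i" for i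
    using that
  proof (induction "Suc (fst t) - i" arbitrary: i)
    case 0
    then have "{v \<in> S. i \<le> fst v} = {}"
      using t(2) by fastforce
    then show ?case
      by (simp only: card.empty)
  next
    case (Suc k)
    define s where "s = card {v \<in> S. fst v = i}"
    define L' where "L' = {v \<in> S. fst v = Suc i}"
    have "leaves L' = {}"
      using Suc.prems by (auto simp: leaves_def L'_def)
    moreover have "finite L'" "L' \<subseteq> verts T_inf"
      using assms(1,2) by (auto simp: L'_def)
    ultimately have "2 * card L' = card (children L')"
      using card_children[of L'] by simp
    also have "\<dots> \<le> s"
      unfolding s_def using assms(1,3) by (intro card_mono) (auto simp: children_def L'_def)
    finally have "card L' \<le> s div 2" by linarith
    have "card {v \<in> S. Suc i \<le> fst v} \<le> floor_halves (card L')"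
      unfolding L'_def using Suc.hyps(2) by (intro Suc.hyps(1)) auto
    also have "\<dots> \<le> floor_halves (s div 2)"
      by (rule floor_halves_mono) fact
    finally show ?case
      using floor_halves_rec[of s] card_from_level[OF assms(1), of i] by (simp add: s_def)
  qed
  have "{v \<in> S. 1 \<le> fst v} = S"
    using assms(2) verts_T_inf by auto
  then show ?thesis
    using level[of 1] by (simp add: leaves_def)
qed simp


section \<open>Extremal sets\<close>

lemma card_level_shift:
  assumes "finite J" "finite S"
  shows "finite (Pair 1 ` J \<union> apfst Suc ` {v \<in> S. 1 \<le> fst v})"
    and "card (Pair 1 ` J \<union> apfst Suc ` {v \<in> S. 1 \<le> fst v}) = card J + card {v \<in> S. 1 \<le> fst v}"
proof -
  let ?A = "Pair 1 ` J" and ?B = "apfst Suc ` {v \<in> S. 1 \<le> fst v}"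
  show "finite (?A \<union> ?B)"
    using assms by simp
  have "card ?B = card {v \<in> S. 1 \<le> fst v}"
    by (intro card_image inj_onI) (auto simp: apfst_def map_prod_def)
  moreover have "card ?A = card J"
    by (intro card_image inj_onI) simp
  ultimately show "card (?A \<union> ?B) = card J + card {v \<in> S. 1 \<le> fst v}"
    using assms by (subst card_Un_disjoint) (auto simp del: One_nat_def)
qed

text \<open>The leftmost leaf below \<open>(i, j)\<close> is \<open>(1, j * 2 ^ (i - 1))\<close>.
  These are the vertices up to level \<open>H\<close> with a descendant among the first
  \<open>m\<close> leaves.\<close>

definition tapered :: "nat \<Rightarrow> nat \<Rightarrow> (nat \<times> nat) set" where
  "tapered m H = {(i, j). 1 \<le> i \<and> i \<le> H \<and> j * 2 ^ (i - 1) < m}"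

text \<open>The vertices all of whose leaf descendants have positions from \<open>a\<close> to below
  \<open>a + q\<close>.\<close>

definition full_trees :: "nat \<Rightarrow> nat \<Rightarrow> (nat \<times> nat) set" where
  "full_trees a q = {(i, j). 1 \<le> i \<and> a \<le> j * 2 ^ (i - 1) \<and> (j + 1) * 2 ^ (i - 1) \<le> a + q}"

section \<open>Optimal connected sets\<close>

lemma finite_tapered [simp]: "finite (tapered m H)"
proof (rule finite_subset)
  show "tapered m H \<subseteq> {..H} \<times> {..<m}"
    by (auto simp: tapered_def intro: le_less_trans[rotated])
qed simp

lemma tapered_Suc: "tapered m (Suc H) =
   Pair 1 ` {..<m} \<union> apfst Suc ` {v \<in> tapered ((m + 1) div 2) H. 1 \<le> fst v}"
proof (intro equalityI subsetI)
  fix v assume v: "v \<in> tapered m (Suc H)"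
  then obtain i j where ij: "v = (Suc i, j)" "i \<le> H" "j * 2 ^ i < m"
    by (cases v; cases "fst v") (auto simp: tapered_def)
  show "v \<in> Pair 1 ` {..<m} \<union> apfst Suc ` {v \<in> tapered ((m + 1) div 2) H. 1 \<le> fst v}"
  proof (cases i)
    case 0
    then show ?thesis using ij by auto
  next
    case (Suc k)
    then have "j * 2 ^ k < (m + 1) div 2"
      using ij(3) by simp
    then have "(i, j) \<in> tapered ((m + 1) div 2) H"
      using ij Suc by (simp add: tapered_def)
    then show ?thesis
      using ij(1) Suc by (intro UnI2 image_eqI[of _ _ "(i, j)"]) auto
  qed
next
  fix v assume "v \<in> Pair 1 ` {..<m} \<union> apfst Suc ` {v \<in> tapered ((m + 1) div 2) H. 1 \<le> fst v}"
  then consider j where "v = (1, j)" "j < m"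
    | i j where "v = (Suc i, j)" "1 \<le> i" "i \<le> H" "j * 2 ^ (i - 1) < (m + 1) div 2"
    by (auto simp: tapered_def)
  then show "v \<in> tapered m (Suc H)"
  proof cases
    case 1
    then show ?thesis by (simp add: tapered_def)
  next
    case (2 i j)
    then obtain k where k: "i = Suc k" by (cases i) auto
    have "j * 2 ^ i < m"
      using 2 k by simp
    then show ?thesis using 2 by (simp add: tapered_def)
  qed
qed

lemma card_tapered_Suc: "card (tapered m (Suc H)) = m + card (tapered ((m + 1) div 2) H)"
proof -
  have "{v \<in> tapered ((m + 1) div 2) H. 1 \<le> fst v} = tapered ((m + 1) div 2) H"
    by (auto simp: tapered_def)
  then show ?thesis
    unfolding tapered_Suc using card_level_shift(2)[of "{..<m}" "tapered ((m + 1) div 2) H"] by simp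
qed

text \<open>Once the rows have narrowed to width 1 they continue as a path upwards, which absorbs
  any surplus over \<open>ceil_halves m\<close>. The bound \<open>m \<le> 2 ^ (H - 1)\<close> says
  that the top row is a single vertex.\<close>

lemma ex_tapered:
  assumes "1 \<le> m" "ceil_halves m \<le> n"
  shows "\<exists>H \<ge> 1. m \<le> 2 ^ (H - 1) \<and> card (tapered m H) = n"
  using assms
proof (induction m arbitrary: n rule: less_induct)
  case (less m)
  show ?case
  proof (cases "m = 1")
    case True
    have "card (tapered 1 n) = n"
    proof (induction n)
      case 0
      have "tapered 1 0 = {}" by (auto simp: tapered_def)
      then show ?case by simp
    qed (simp add: card_tapered_Suc)
    then show ?thesis
      using less.prems True by (intro exI[of _ n]) auto
  next
    case False
    then have m: "2 \<le> m" using less.prems by simp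
    have "ceil_halves ((m + 1) div 2) \<le> n - m" "m \<le> n"
      using less.prems(2) ceil_halves_rec[OF m] by linarith+
    moreover have "(m + 1) div 2 < m" "1 \<le> (m + 1) div 2"
      using m by linarith+
    ultimately obtain H where H: "H \<ge> 1" "(m + 1) div 2 \<le> 2 ^ (H - 1)"
      "card (tapered ((m + 1) div 2) H) = n - m"
      using less.IH[of "(m + 1) div 2" "n - m"] by blast
    have "m \<le> 2 * 2 ^ (H - 1)"
      using H(2) by linarith
    also have "\<dots> = 2 ^ (Suc H - 1)"
      using H(1) by (simp flip: power_Suc)
    finally have "m \<le> 2 ^ (Suc H - 1)" .
    moreover have "card (tapered m (Suc H)) = n"
      using H(3) \<open>m \<le> n\<close> by (simp add: card_tapered_Suc)
    ultimately show ?thesis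
      by (intro exI[of _ "Suc H"]) simp
  qed
qed

lemma parent_in_tapered:
  assumes "v \<in> tapered m H" "m \<le> 2 ^ (H - 1)" "v \<noteq> (H, 0)"
  shows "parent v \<in> tapered m H" "fst v < H"
proof -
  obtain i j where ij: "v = (Suc i, j)" "Suc i \<le> H" "j * 2 ^ i < m"
    using assms(1) by (cases v; cases "fst v") (auto simp: tapered_def)
  have "Suc i \<noteq> H"
  proof
    assume "Suc i = H"
    then have "j * 2 ^ i < 2 ^ i"
      using ij(3) assms(2) by (metis diff_Suc_1 less_le_trans)
    then show False
      using assms(3) ij(1) \<open>Suc i = H\<close> by simp
  qed
  then show "fst v < H" using ij by simp
  have "j div 2 * 2 ^ Suc i = j div 2 * 2 * 2 ^ i"
    by simp
  also have "\<dots> \<le> j * 2 ^ i"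
    by (intro mult_le_mono1) simp
  finally have "j div 2 * 2 ^ Suc i < m"
    using ij(3) by (rule le_less_trans)
  then show "parent v \<in> tapered m H"
    using ij \<open>Suc i \<noteq> H\<close> by (simp add: tapered_def parent_def)
qed

lemma ex_connected_set:
  assumes "1 \<le> n"
  obtains S where "finite S" "S \<subseteq> verts T_inf" "card S = n" "connected (T_inf \<restriction> S)"
    "card (edge_boundary S) + 2 * tanny n = n + 2" "S \<subseteq> {(i, j). j * 2 ^ (i - 1) < tanny n}"
proof -
  define m where "m = tanny n"
  have m: "1 \<le> m" "ceil_halves m \<le> n"
    using tanny_bounds le_tanny_iff[OF assms, of m] by (simp_all add: m_def)
  then obtain H where H: "H \<ge> 1" "m \<le> 2 ^ (H - 1)" "card (tapered m H) = n"
    using ex_tapered by blast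
  let ?S = "tapered m H"
  have sub: "?S \<subseteq> verts T_inf"
    by (auto simp: verts_T_inf tapered_def)
  have top: "(H, 0) \<in> ?S"
    using H m by (simp add: tapered_def)
  note par = parent_in_tapered[OF _ H(2)]
  have "roots ?S = {(H, 0)}"
    using top par(1) by (auto simp: roots_def tapered_def parent_def)
  moreover have "leaves ?S = Pair 1 ` {..<m}"
    using H by (auto simp: leaves_def tapered_def)
  then have "card (leaves ?S) = m"
    by (simp add: card_image inj_on_def)
  ultimately have "card (edge_boundary ?S) + 2 * m = n + 2"
    using card_edge_boundary[OF _ sub] H(3) by simp
  moreover have "connected (T_inf \<restriction> ?S)"
    using par by (intro connected_rooted[OF sub top]) auto
  moreover have "?S \<subseteq> {(i, j). j * 2 ^ (i - 1) < m}"
    by (auto simp: tapered_def)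
  ultimately show ?thesis
    using that[OF finite_tapered sub H(3)] unfolding m_def by blast
qed

section \<open>Optimal sets with connected complement\<close>

lemma full_trees_double: "full_trees (2 * a) q =
   Pair 1 ` {2 * a..<2 * a + q} \<union> apfst Suc ` {v \<in> full_trees a (q div 2). 1 \<le> fst v}"
proof -
  have half: "(j + 1) * (2 * P) \<le> 2 * a + q \<longleftrightarrow> (j + 1) * P \<le> a + q div 2" for j P :: nat
  proof -
    have "(j + 1) * (2 * P) = 2 * ((j + 1) * P)" by simp
    then show ?thesis by linarith
  qed
  show ?thesis
  proof (intro equalityI subsetI)
    fix v assume v: "v \<in> full_trees (2 * a) q"
    then obtain i j where ij: "v = (Suc i, j)" "2 * a \<le> j * 2 ^ i" "(j + 1) * 2 ^ i \<le> 2 * a + q"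
      by (cases v; cases "fst v") (auto simp: full_trees_def)
    show "v \<in> Pair 1 ` {2 * a..<2 * a + q} \<union> apfst Suc ` {v \<in> full_trees a (q div 2). 1 \<le> fst v}"
    proof (cases i)
      case 0
      then show ?thesis using ij by auto
    next
      case (Suc k)
      have "a \<le> j * 2 ^ k" "(j + 1) * 2 ^ k \<le> a + q div 2"
        using ij(2,3) half[of j "2 ^ k"] Suc by simp_all
      then have "(i, j) \<in> full_trees a (q div 2)"
        using Suc by (simp add: full_trees_def)
      then show ?thesis
        using ij(1) Suc by (intro UnI2 image_eqI[of _ _ "(i, j)"]) auto
    qed
  next
    fix v assume "v \<in> Pair 1 ` {2 * a..<2 * a + q} \<union> apfst Suc ` {v \<in> full_trees a (q div 2). 1 \<le> fst v}"
    then consider j where "v = (1, j)" "2 * a \<le> j" "j < 2 * a + q"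
      | i j where "v = (Suc i, j)" "1 \<le> i" "a \<le> j * 2 ^ (i - 1)" "(j + 1) * 2 ^ (i - 1) \<le> a + q div 2"
      by (auto simp: full_trees_def)
    then show "v \<in> full_trees (2 * a) q"
    proof cases
      case 1
      then show ?thesis by (simp add: full_trees_def)
    next
      case (2 i j)
      then obtain k where k: "i = Suc k" by (cases i) auto
      have "2 * a \<le> j * 2 ^ i" "(j + 1) * 2 ^ i \<le> 2 * a + q"
        using 2 k half[of j "2 ^ k"] by simp_all
      then show ?thesis using 2 by (simp add: full_trees_def)
    qed
  qed
qed

text \<open>Pairs of siblings must line up with the left end of every row, so \<open>a\<close> is
  doubled at each halving of \<open>q\<close>. The free bound \<open>b\<close> allows the trees to
  be placed far to the right.\<close>

lemma ex_full_trees: "\<exists>a \<ge> b. finite (full_trees a q) \<and> card (full_trees a q) = floor_halves q"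
proof (induction q rule: less_induct)
  case (less q)
  show ?case
  proof (cases "q = 0")
    case True
    have "full_trees b 0 = {}"
    proof (intro equals0I)
      fix v assume "v \<in> full_trees b 0"
      then obtain i j where "b \<le> j * 2 ^ (i - 1)" "(j + 1) * 2 ^ (i - 1) \<le> b"
        by (cases v) (auto simp: full_trees_def)
      then have "(2::nat) ^ (i - 1) \<le> 0"
        unfolding distrib_right by linarith
      then show False by simp
    qed
    then show ?thesis
      using True by (intro exI[of _ b]) simp
  next
    case False
    then obtain a where a: "a \<ge> b" "finite (full_trees a (q div 2))"
      "card (full_trees a (q div 2)) = floor_halves (q div 2)"
      using less.IH[of "q div 2"] by auto
    have "{v \<in> full_trees a (q div 2). 1 \<le> fst v} = full_trees a (q div 2)"
      by (auto simp: full_trees_def)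
    then have "finite (full_trees (2 * a) q)" "card (full_trees (2 * a) q) = floor_halves q"
      unfolding full_trees_double
      using card_level_shift[of "{2 * a..<2 * a + q}" "full_trees a (q div 2)"] a floor_halves_rec[of q]
      by simp_all
    then show ?thesis
      using a(1) by (intro exI[of _ "2 * a"]) simp
  qed
qed

lemma full_trees_closed:
  assumes "1 \<le> fst v" "parent v \<in> full_trees a q"
  shows "v \<in> full_trees a q"
proof -
  obtain i j where v: "v = (Suc i, j)"
    using assms(1) by (cases v; cases "fst v") auto
  have *: "a \<le> j div 2 * 2 ^ Suc i" "(j div 2 + 1) * 2 ^ Suc i \<le> a + q"
    using assms(2) v by (simp_all add: full_trees_def parent_def)
  have "j div 2 * 2 ^ Suc i \<le> j * 2 ^ i"
  proof -
    have "j div 2 * 2 ^ Suc i = (j div 2 * 2) * 2 ^ i" by simp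
    also have "\<dots> \<le> j * 2 ^ i" by (intro mult_le_mono1) simp
    finally show ?thesis .
  qed
  from *(1) this have 1: "a \<le> j * 2 ^ i" by (rule le_trans)
  have "(j + 1) * 2 ^ i \<le> (j div 2 + 1) * 2 ^ Suc i"
  proof -
    have "(j + 1) * 2 ^ i \<le> ((j div 2 + 1) * 2) * 2 ^ i" by (intro mult_le_mono1) simp
    then show ?thesis by (simp only: power_Suc mult.assoc)
  qed
  from this *(2) have "(j + 1) * 2 ^ i \<le> a + q" by (rule le_trans)
  then show ?thesis
    using v 1 by (simp add: full_trees_def)
qed

text \<open>A highest vertex can be deleted without losing closure, since its parent is not in the
  set. It is no leaf as long as the set is larger than its set of leaves.\<close>

lemma ex_closed_subset:
  assumes "finite S" "S \<subseteq> verts T_inf" "\<And>v. 1 \<le> fst v \<Longrightarrow> parent v \<in> S \<Longrightarrow> v \<in> S"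
    and "card (leaves S) \<le> n" "n \<le> card S"
  shows "\<exists>S' \<subseteq> S. card S' = n \<and> leaves S' = leaves S \<and>
           (\<forall>v. 1 \<le> fst v \<longrightarrow> parent v \<in> S' \<longrightarrow> v \<in> S')"
  using assms
proof (induction "card S" arbitrary: S rule: less_induct)
  case less
  show ?case
  proof (cases "n = card S")
    case True
    then show ?thesis
      using less.prems(3) by (intro exI[of _ S]) blast
  next
    case False
    then have lt: "card (leaves S) < card S" "n < card S"
      using less.prems by linarith+
    then have "S \<noteq> {}" by auto
    then obtain t where t: "t \<in> S" "\<And>v. v \<in> S \<Longrightarrow> fst v \<le> fst t"
      using obtain_max_level[OF less.prems(1)] by metis
    have "fst t \<noteq> 1"
    proof
      assume "fst t = 1"
      then have "fst v = 1" if "v \<in> S" for v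
        using t(2)[OF that] subsetD[OF less.prems(2) that] by (simp add: verts_T_inf)
      then have "leaves S = S"
        by (auto simp: leaves_def)
      then show False using lt(1) by simp
    qed
    then have leaves: "leaves (S - {t}) = leaves S"
      by (auto simp: leaves_def)
    have "\<exists>S' \<subseteq> S - {t}. card S' = n \<and> leaves S' = leaves (S - {t}) \<and>
           (\<forall>v. 1 \<le> fst v \<longrightarrow> parent v \<in> S' \<longrightarrow> v \<in> S')"
    proof (rule less.hyps)
      show "card (S - {t}) < card S" "finite (S - {t})" "S - {t} \<subseteq> verts T_inf"
        using less.prems t(1) lt by (auto simp: card_gt_0_iff)
      show "v \<in> S - {t}" if v: "1 \<le> fst v" "parent v \<in> S - {t}" for v
        using v less.prems(3)[OF v(1)] t(2)[of "parent v"] by auto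
      show "card (leaves (S - {t})) \<le> n"
        using leaves less.prems(4) by simp
      show "n \<le> card (S - {t})"
        using t(1) less.prems(1) lt(2) by simp
    qed
    then show ?thesis
      unfolding leaves by blast
  qed
qed

text \<open>No edge leaves a closed set downwards, and its non-roots are exactly the children of its
  non-leaves.\<close>

lemma closed_boundary:
  assumes "finite S" "S \<subseteq> verts T_inf" "\<And>v. 1 \<le> fst v \<Longrightarrow> parent v \<in> S \<Longrightarrow> v \<in> S"
  shows "card (edge_boundary S) + card S = 2 * card (leaves S)"
proof -
  have "children S = S - roots S"
    using assms(2,3) by (auto simp: children_def roots_def verts_T_inf simp del: split_paired_All)
  then have "card (children S) + card (roots S) = card S"
    using assms(1) card_mono[of S "roots S"] by (simp add: card_Diff_subset roots_def)
  moreover have "card (S - leaves S) + card (leaves S) = card S"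
    using assms(1) card_mono[of S "leaves S"] by (simp add: card_Diff_subset leaves_def)
  ultimately show ?thesis
    using card_edge_boundary[OF assms(1,2)] card_children[OF assms(1,2)] by linarith
qed

lemma ex_closed_set:
  obtains S where "finite S" "S \<subseteq> verts T_inf" "card S = n" "connected (T_inf \<restriction> (verts T_inf - S))"
    "card (edge_boundary S) + n = 2 * conolly n" "S \<subseteq> {(i, j). b \<le> j * 2 ^ (i - 1)}"
proof -
  define q where "q = conolly n"
  obtain a where a: "a \<ge> b" "finite (full_trees a q)" "card (full_trees a q) = floor_halves q"
    using ex_full_trees by blast
  have leaves: "leaves (full_trees a q) = Pair 1 ` {a..<a + q}"
    by (auto simp: leaves_def full_trees_def)
  have card_leaves: "card (leaves (full_trees a q)) = q"
    unfolding leaves by (simp add: card_image inj_on_def)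
  have sub: "full_trees a q \<subseteq> verts T_inf"
    by (auto simp: full_trees_def verts_T_inf)
  \<comment> \<open>Full trees on \<open>q\<close> leaves thus have enough vertices, and can be cut
    down to \<open>n\<close> of them while keeping every leaf.\<close>
  have "q \<le> n" "n \<le> floor_halves q"
    using conolly_bounds(2) conolly_le_iff[of n q] by (simp_all add: q_def)
  then obtain S where S: "S \<subseteq> full_trees a q" "card S = n" "leaves S = leaves (full_trees a q)"
    "\<And>v. 1 \<le> fst v \<Longrightarrow> parent v \<in> S \<Longrightarrow> v \<in> S"
    using ex_closed_subset[OF a(2) sub full_trees_closed, of n] card_leaves a(3) by auto
  have fin: "finite S" and sub': "S \<subseteq> verts T_inf"
    using S(1) a(2) sub finite_subset by blast+
  have "card (edge_boundary S) + n = 2 * q"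
    using closed_boundary[OF fin sub' S(4)] card_leaves S(2,3) by simp
  moreover have "connected (T_inf \<restriction> (verts T_inf - S))"
  proof (rule connected_parent_closed)
    have "finite (insert 0 (fst ` S))" using fin by simp
    then obtain K where "\<And>x. x \<in> insert 0 (fst ` S) \<Longrightarrow> x \<le> K"
      by (meson finite_nat_set_iff_bounded_le)
    then have "(Suc K, 0) \<in> verts T_inf - S"
      by (force simp: verts_T_inf)
    then show "verts T_inf - S \<noteq> {}" by blast
  qed (use S(4) in \<open>auto simp: verts_T_inf simp del: split_paired_All\<close>)
  moreover have "S \<subseteq> {(i, j). b \<le> j * 2 ^ (i - 1)}"
    using S(1) a(1) by (auto simp: full_trees_def)
  ultimately show ?thesis
    using that[OF fin sub' S(2)] by (simp add: q_def)
qed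


section \<open>The isoperimetric functions in terms of the sequences\<close>

lemma Inf_nat_eq:
  fixes m :: nat
  assumes "m \<in> A" "\<And>x. x \<in> A \<Longrightarrow> m \<le> x"
  shows "Inf A = m"
  using assms by (intro antisym cInf_lower cInf_greatest) auto

lemma delta_C_eq: "delta_C n + 2 * tanny n = n + 2"
proof (cases "n = 0")
  \<comment> \<open>The convention \<open>delta_C 0 = 0\<close> fits the formula because
    \<open>tanny 0 = 1\<close>.\<close>
  case True
  then show ?thesis by (simp add: delta_C_def tanny_small)
next
  case False
  then obtain S0 where S0: "finite S0" "S0 \<subseteq> verts T_inf" "card S0 = n" "connected (T_inf \<restriction> S0)"
    "card (edge_boundary S0) + 2 * tanny n = n + 2"
    using ex_connected_set[of n] by auto
  have "delta_C n = card (edge_boundary S0)"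
    unfolding delta_C_def using False
  proof (simp, intro Inf_nat_eq)
    show "card (edge_boundary S0) \<in> {card (edge_boundary S) |S. S \<subseteq> verts T_inf \<and> finite S \<and>
        card S = n \<and> connected (T_inf \<restriction> S)}"
      using S0 by blast
    fix x assume "x \<in> {card (edge_boundary S) |S. S \<subseteq> verts T_inf \<and> finite S \<and>
        card S = n \<and> connected (T_inf \<restriction> S)}"
    then obtain S where x: "x = card (edge_boundary S)" and S: "S \<subseteq> verts T_inf" "finite S" "card S = n"
      "connected (T_inf \<restriction> S)"
      by blast
    obtain r where r: "r \<in> S" "\<And>v. v \<in> S \<Longrightarrow> v \<noteq> r \<Longrightarrow> parent v \<in> S"
      using connected_imp_rooted[OF S(2,4)] by metis
    have "card (leaves S) \<le> tanny n"
      using rooted_leaves_le_tanny[OF S(2,1) r] S(3) by simp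
    moreover have "roots S \<noteq> {}"
    proof -
      obtain t where t: "t \<in> S" "\<And>v. v \<in> S \<Longrightarrow> fst v \<le> fst t"
        using obtain_max_level[OF S(2)] r(1) by blast
      have "t \<in> roots S"
        using t(1) t(2)[of "parent t"] by (auto simp: roots_def)
      then show ?thesis
        by blast
    qed
    then have "1 \<le> card (roots S)"
      using S(2) by (simp add: Suc_le_eq card_gt_0_iff)
    ultimately show "card (edge_boundary S0) \<le> x"
      using card_edge_boundary[OF S(2,1)] S(3) S0(5) x by linarith
  qed
  then show ?thesis using S0(5) by simp
qed

lemma delta_P_eq: "delta_P n + n = 2 * conolly n"
proof (cases "n = 0")
  case True
  then show ?thesis using conolly_bounds(2)[of 0] by (simp add: delta_P_def)
next
  case False
  obtain S0 where S0: "finite S0" "S0 \<subseteq> verts T_inf" "card S0 = n"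
    "connected (T_inf \<restriction> (verts T_inf - S0))" "card (edge_boundary S0) + n = 2 * conolly n"
    using ex_closed_set[of n 0] by metis
  have "delta_P n = card (edge_boundary S0)"
    unfolding delta_P_def using False
  proof (simp, intro Inf_nat_eq)
    show "card (edge_boundary S0) \<in> {card (edge_boundary S) |S. S \<subseteq> verts T_inf \<and> finite S \<and>
        card S = n \<and> connected (T_inf \<restriction> (verts T_inf - S))}"
      using S0 by blast
    fix x assume "x \<in> {card (edge_boundary S) |S. S \<subseteq> verts T_inf \<and> finite S \<and>
        card S = n \<and> connected (T_inf \<restriction> (verts T_inf - S))}"
    then obtain S where x: "x = card (edge_boundary S)" and S: "S \<subseteq> verts T_inf" "finite S" "card S = n"
      "connected (T_inf \<restriction> (verts T_inf - S))"
      by blast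
    have closed: "v \<in> S" if "1 \<le> fst v" "parent v \<in> S" for v
      using connected_complement_imp_closed[OF S(2,4) that(2,1)] .
    have "conolly n \<le> card (leaves S)"
      using closed_card_le_floor_halves_leaves[OF S(2,1) closed] S(3) by (simp add: conolly_le_iff)
    then show "card (edge_boundary S0) \<le> x"
      using closed_boundary[OF S(2,1) closed] S(3) S0(5) x by linarith
  qed
  then show ?thesis using S0(5) by simp
qed

lemma delta_le:
  assumes "v \<le> n"
  shows "delta n \<le> delta_P v + delta_C (n - v)"
proof -
  obtain P where P: "finite P" "P \<subseteq> verts T_inf" "card P = v" "card (edge_boundary P) + v = 2 * conolly v"
    "P \<subseteq> {(i, j). tanny (n - v) \<le> j * 2 ^ (i - 1)}"
    \<comment> \<open>The bound is chosen so that the leftmost leaves below vertices of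
      \<open>P\<close> lie to the right of those for \<open>Q\<close>; this makes the sets
      disjoint.\<close>
    using ex_closed_set[of v "tanny (n - v)"] by metis
  obtain Q where Q: "finite Q" "Q \<subseteq> verts T_inf" "card Q = n - v"
    "card (edge_boundary Q) \<le> delta_C (n - v)" "Q \<subseteq> {(i, j). j * 2 ^ (i - 1) < tanny (n - v)}"
  proof (cases "n - v = 0")
    case True
    then show ?thesis using that[of "{}"] by (simp add: edge_boundary_def)
  next
    case False
    then obtain Q where Q: "finite Q" "Q \<subseteq> verts T_inf" "card Q = n - v"
      "card (edge_boundary Q) + 2 * tanny (n - v) = n - v + 2" "Q \<subseteq> {(i, j). j * 2 ^ (i - 1) < tanny (n - v)}"
      using ex_connected_set[of "n - v"] by (metis One_nat_def Suc_leI neq0_conv)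
    then show ?thesis using that[of Q] delta_C_eq[of "n - v"] by simp
  qed
  have "P \<inter> Q = {}"
  proof (intro equals0I)
    fix v assume "v \<in> P \<inter> Q"
    then show False
      using subsetD[OF P(5), of v] subsetD[OF Q(5), of v] by (cases v) simp
  qed
  then have card: "card (P \<union> Q) = n"
    using P(1,3) Q(1,3) assms by (simp add: card_Un_disjoint)
  have "delta n \<le> card (edge_boundary (P \<union> Q))"
    unfolding delta_def using P(1,2) Q(1,2) card by (intro cInf_lower) auto
  also have "\<dots> \<le> card (edge_boundary P \<union> edge_boundary Q)"
    \<comment> \<open>An edge between \<open>P\<close> and \<open>Q\<close> would only disappear
      from the boundary of the union.\<close>
    by (intro card_mono finite_UnI finite_edge_boundary P(1) Q(1)) (auto simp: edge_boundary_def)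
  also have "\<dots> \<le> card (edge_boundary P) + card (edge_boundary Q)"
    by (rule card_Un_le)
  also have "\<dots> \<le> delta_P v + delta_C (n - v)"
    using P(4) Q(4) delta_P_eq[of v] by simp
  finally show ?thesis .
qed

text \<open>
  The components are removed one at a time, starting with a root of least level. The component of
  such a root consists of all its descendants in the set.
\<close>

lemma leaves_roots_bound:
  assumes "finite S" "S \<subseteq> verts T_inf"
  shows "\<exists>v \<le> card S. card (leaves S) + conolly v + 1 \<le> v + tanny (card S - v) + card (roots S)"
  using assms
proof (induction "card S" arbitrary: S rule: less_induct)
  case less
  note fin = less.prems(1) and sub = less.prems(2)
  show ?case
  proof (cases "S = {}")
    case True
    \<comment> \<open>With \<open>v = 0\<close> the extra 1 on the left is paid for by
      \<open>tanny 0 = 1\<close>.\<close>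
    then show ?thesis
      using conolly_bounds(2)[of 0] by (simp add: leaves_def roots_def tanny_small)
  next
    case False
    then obtain t where t: "t \<in> S" "\<And>v. v \<in> S \<Longrightarrow> fst v \<le> fst t"
      using obtain_max_level[OF fin] by blast
    then have "t \<in> roots S"
      using t(2)[of "parent t"] by (auto simp: roots_def)
    then have "\<exists>r. r \<in> roots S \<and> (\<forall>v. v \<in> roots S \<longrightarrow> fst r \<le> fst v)"
      using ex_has_least_nat[of "\<lambda>r. r \<in> roots S" t fst] by blast
    then obtain r where r: "r \<in> roots S" "\<And>v. v \<in> roots S \<Longrightarrow> fst r \<le> fst v"
      by blast
    then have rS: "r \<in> S" "parent r \<notin> S" by (auto simp: roots_def)
    define B where "B = S \<inter> descendants r"
    define S' where "S' = S - B"
    have rB: "r \<in> B"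
      using rS by (simp add: B_def)
    \<comment> \<open>A further root among the descendants of \<open>r\<close> would have a smaller
      level than \<open>r\<close>.\<close>
    have par: "parent v \<in> B" if "v \<in> B" "v \<noteq> r" for v
    proof -
      have "v \<notin> roots S"
        using that descendants_levelD[of v r] r(2)[of v] by (auto simp: B_def)
      then show ?thesis
        using that descendants_parentI[of v r] by (auto simp: B_def roots_def)
    qed
    have finB: "finite B" "B \<subseteq> verts T_inf" "finite S'" "S' \<subseteq> verts T_inf"
      using fin sub by (auto simp: B_def S'_def)
    have S: "S = B \<union> S'" "B \<inter> S' = {}"
      by (auto simp: S'_def B_def)
    have "roots S = insert r (roots S')"
    proof (intro equalityI subsetI)
      fix v assume "v \<in> roots S"
      then show "v \<in> insert r (roots S')"
        using par[of v] by (auto simp: roots_def S'_def B_def)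
    next
      fix v assume "v \<in> insert r (roots S')"
      then show "v \<in> roots S"
        using r(1) parent_in_descendantsD[of v r] by (auto simp: roots_def S'_def B_def)
    qed
    moreover have "r \<notin> roots S'"
      using rB by (auto simp: roots_def S'_def)
    ultimately have c: "card (roots S) = Suc (card (roots S'))"
      using finB(3) by simp
    have "leaves S = leaves B \<union> leaves S'" "leaves B \<inter> leaves S' = {}"
      using S by (auto simp: leaves_def)
    then have L: "card (leaves S) = card (leaves B) + card (leaves S')"
      using finB by (simp add: card_Un_disjoint)
    have n: "card S = card B + card S'"
      using S finB by (metis card_Un_disjoint)
    have b: "1 \<le> card B"
      using finB(1) rB by (metis One_nat_def Suc_leI card_gt_0_iff empty_iff)
    have k: "card (leaves B) \<le> tanny (card B)"
      by (rule rooted_leaves_le_tanny[OF finB(1,2) rB par])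
    obtain v where v: "v \<le> card S'"
      "card (leaves S') + conolly v + 1 \<le> v + tanny (card S' - v) + card (roots S')"
      using less.hyps[OF _ finB(3,4)] n b by auto
    show ?thesis
    \<comment> \<open>If the closed part uses up all of \<open>S'\<close>, then \<open>B\<close>
      itself serves as the connected part. Otherwise two connected parts compete and are
      exchanged.\<close>
    proof (cases "card S' - v = 0")
      case True
      have "card S - v = card B"
        using True v(1) n by simp
      then have "card (leaves S) + conolly v + 1 \<le> v + tanny (card S - v) + card (roots S)"
        using v k L c True tanny_small[of 0] by simp
      then show ?thesis
        using v(1) n by (intro exI[of _ v]) simp
    next
      case False
      then obtain w where w: "w \<le> card S' - v + card B"
        "tanny (card S' - v) + tanny (card B) + conolly w \<le> 1 + w + tanny (card S' - v + card B - w)"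
        using tanny_exchange[of "card S' - v" "card B"] b by (metis One_nat_def Suc_leI neq0_conv)
      have eq: "card S - (v + w) = card S' - v + card B - w"
        using v(1) n by simp
      have "card (leaves S) + conolly (v + w) + 1 \<le> (v + w) + tanny (card S - (v + w)) + card (roots S)"
        \<comment> \<open>The closed part obtained from \<open>S'\<close> and the one split off by
          the exchange are merged into one of size \<open>v + w\<close>.\<close>
        unfolding eq using conolly_subadd[of v w] w(2) v(2) k L c by linarith
      then show ?thesis
        using w(1) v(1) n by (intro exI[of _ "v + w"]) simp
    qed
  qed
qed

text \<open>For an optimal set, doubling the bound on leaves minus roots and inserting it into the
  boundary formula gives exactly the formulas for \<open>delta_P\<close> and
  \<open>delta_C\<close>.\<close>

lemma delta_attained: "\<exists>v \<le> n. delta_P v + delta_C (n - v) \<le> delta n"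
proof -
  obtain S0 :: "(nat \<times> nat) set" where "finite S0" "S0 \<subseteq> verts T_inf" "card S0 = n"
    using ex_closed_set[of n 0] by metis
  then have "{card (edge_boundary S) |S. S \<subseteq> verts T_inf \<and> finite S \<and> card S = n} \<noteq> {}"
    by blast
  then have "delta n \<in> {card (edge_boundary S) |S. S \<subseteq> verts T_inf \<and> finite S \<and> card S = n}"
    unfolding delta_def by (rule Inf_nat_def1)
  then obtain S where S: "delta n = card (edge_boundary S)" "S \<subseteq> verts T_inf" "finite S" "card S = n"
    by blast
  obtain v where v: "v \<le> n" "card (leaves S) + conolly v + 1 \<le> v + tanny (n - v) + card (roots S)"
    using leaves_roots_bound[OF S(3,2)] S(4) by blast
  have "delta_P v + delta_C (n - v) \<le> delta n"
    using v card_edge_boundary[OF S(3,2)] S(1,4) delta_P_eq[of v] delta_C_eq[of "n - v"] by linarith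
  then show ?thesis
    using v(1) by blast
qed

theorem theorem3p14:
  fixes n :: nat
  assumes "n \<ge> 1"
  shows "delta n = Min {delta_P v + delta_C (n - v) | v. v \<le> n} \<and>
         int (delta n) = int n + 2 + 2 * Min {int (conolly v) - int (tanny (n - v)) - int v | v. v \<le> n}"
proof
  obtain v0 where v0: "v0 \<le> n" "delta_P v0 + delta_C (n - v0) \<le> delta n"
    using delta_attained by blast
  then have eq: "delta n = delta_P v0 + delta_C (n - v0)"
    using delta_le[OF v0(1)] by simp
  show "delta n = Min {delta_P v + delta_C (n - v) | v. v \<le> n}"
    using v0(1) eq delta_le[of _ n] by (intro Min_eqI[symmetric]) fastforce+
  \<comment> \<open>The sum for \<open>v\<close> is an increasing affine function of
    \<open>f v\<close>, so both minima are attained at the same \<open>v0\<close>. Integers are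
    needed because \<open>f\<close> takes negative values.\<close>
  define f where "f v = int (conolly v) - int (tanny (n - v)) - int v" for v
  have f: "int (delta_P v + delta_C (n - v)) = int n + 2 + 2 * f v" if "v \<le> n" for v
  proof -
    have "int (delta_P v) + int v = 2 * int (conolly v)"
      using arg_cong[OF delta_P_eq[of v], of int] by simp
    moreover have "int (delta_C (n - v)) + 2 * int (tanny (n - v)) = int n - int v + 2"
      using arg_cong[OF delta_C_eq[of "n - v"], of int] that by (simp add: of_nat_diff)
    ultimately show ?thesis
      unfolding f_def by simp
  qed
  have "Min {f v | v. v \<le> n} = f v0"
  proof (intro Min_eqI)
    fix y assume "y \<in> {f v | v. v \<le> n}"
    then obtain v where v: "v \<le> n" "y = f v" by blast
    then show "f v0 \<le> y"
      using f[OF v(1)] f[OF v0(1)] delta_le[OF v(1)] eq by linarith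
  qed (use v0 in auto)
  then show "int (delta n) = int n + 2 + 2 * Min {int (conolly v) - int (tanny (n - v)) - int v | v. v \<le> n}"
    using f[OF v0(1)] eq by (simp add: f_def)
qed

end
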